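(* Let $E\subset\mathbb{C}$ be a compact set which is symmetric with respect to the real axis (i.e. $\bar z\in E$ whenever $z\in E$) and satisfies $\operatorname{cap}(E)\ge 1$. Then $t_M(E)=\operatorname{cap}(E)$.
   Context: $\operatorname{cap}(E)$ is the logarithmic capacity of $E$ (equal to its transfinite diameter and to its classical Chebyshev constant $\lim_n \|t_n\|_E^{1/n}$, where $t_n$ is the monic complex polynomial of degree $n$ of least sup norm on $E$). For compact $E\subset\mathbb{C}$, $\|f\|_E:=\sup_{z\in E}|f(z)|$; $\mathcal{M}_n(\mathbb{Z})$ is the set of monic integer-coefficient polynomials of exact degree $n$; and the monic integer Chebyshev constant is $t_M(E):=\lim_{n\to\infty}\big(\inf_{P\in\mathcal{M}_n(\mathbb{Z})}\|P\|_E\big)^{1/n}$ (this limit exists). *)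

theory Defs
  imports "HOL-Probability.Probability" "HOL-Computational_Algebra.Computational_Algebra"
begin

section \<open>Logarithmic capacity\<close>

definition prob_measures_on :: "complex set \<Rightarrow> complex measure set" where
  "prob_measures_on E = {\<mu>. prob_space \<mu> \<and> sets \<mu> = sets borel \<and> emeasure \<mu> E = 1}"

text \<open>The kernel \<open>log (1 / |z - w|)\<close> takes the value \<open>\<infinity>\<close> on the diagonal, where the
  library convention \<open>ln 0 = 0\<close> would give a wrong value.\<close>

definition log_kernel :: "complex \<Rightarrow> complex \<Rightarrow> ereal" where
  "log_kernel z w = (if z = w then \<infinity> else ereal (ln (1 / cmod (z - w))))"

text \<open>The energy \<open>\<integral>\<integral> log (1 / |z - w|) d\<mu>(z) d\<mu>(w)\<close>, with values in \<open>(-\<infinity>, \<infinity>]\<close>, as the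
  integral of the positive part minus that of the negative part (\<open>e2ennreal\<close> sends negative
  numbers to \<open>0\<close>). For a measure concentrated on a bounded set the second term is finite, so the
  difference \<open>\<infinity> - \<infinity>\<close> does not occur.\<close>

definition log_energy :: "complex measure \<Rightarrow> ereal" where
  "log_energy \<mu> =
     enn2ereal (\<integral>\<^sup>+ w. \<integral>\<^sup>+ z. e2ennreal (log_kernel z w) \<partial>\<mu> \<partial>\<mu>)
     - enn2ereal (\<integral>\<^sup>+ w. \<integral>\<^sup>+ z. e2ennreal (- log_kernel z w) \<partial>\<mu> \<partial>\<mu>)"

definition robin_constant :: "complex set \<Rightarrow> ereal" where
  "robin_constant E = (INF \<mu>\<in>prob_measures_on E. log_energy \<mu>)"

text \<open>\<open>cap E = exp (- V)\<close> for the Robin constant \<open>V\<close>, with \<open>exp (-\<infinity>) = 0\<close>. For compact \<open>E\<close> one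
  has \<open>V > -\<infinity>\<close>; for empty \<open>E\<close> the infimum is \<open>\<infinity>\<close> and the capacity \<open>0\<close>.\<close>

definition log_capacity :: "complex set \<Rightarrow> real" where
  "log_capacity E =
     (if robin_constant E = \<infinity> then 0 else exp (- real_of_ereal (robin_constant E)))"

section \<open>The monic integer Chebyshev constant\<close>

definition sup_norm_on :: "complex set \<Rightarrow> (complex \<Rightarrow> complex) \<Rightarrow> real" where
  "sup_norm_on E f = (SUP z\<in>E. cmod (f z))"

definition monic_int_polys :: "nat \<Rightarrow> int poly set" where
  "monic_int_polys n = {P. degree P = n \<and> lead_coeff P = 1}"

definition monic_int_cheb_seq :: "complex set \<Rightarrow> nat \<Rightarrow> real" where
  "monic_int_cheb_seq E n =
     root n (INF P\<in>monic_int_polys n. sup_norm_on E (poly (map_poly of_int P)))"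

definition monic_int_cheb_const :: "complex set \<Rightarrow> real" where
  "monic_int_cheb_const E = lim (monic_int_cheb_seq E)"

end

theory Submission imports Defs "HOL-Real_Asymp.Real_Asymp" begin

text \<open>
  The two inequalities rest on the equality of the logarithmic capacity \<open>c\<close> with the Chebyshev
  constant of \<open>E\<close>.

  Let \<open>P\<close> be monic of degree \<open>n\<close> with \<open>|P| \<le> M\<close> on \<open>E\<close>. Divided differences bound the Vandermonde
  product of \<open>m\<close> points of \<open>E\<close> by \<open>\<Prod>k<m. (k + 1) \<parallel>T k\<parallel>\<close> for any monic \<open>T k\<close> of degree \<open>k\<close>. With
  \<open>T k = z ^ (k mod n) * P ^ (k div n)\<close> and integration against an arbitrary probability measure in
  all \<open>m\<close> variables, this bounds its energy from below by \<open>- ln M / n\<close> as \<open>m\<close> tends to infinity;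
  hence \<open>c ^ n \<le> M\<close>.

  Conversely, let \<open>\<parallel>P\<parallel> \<ge> \<tau> ^ degree P\<close> for all monic \<open>P\<close>. Then a weak limit of uniform measures on
  almost extremal \<open>m\<close>-point sets has energy at most \<open>- ln \<tau>\<close>, so \<open>\<tau> \<le> c\<close>. For \<open>\<tau> > c\<close> there are
  therefore monic polynomials \<open>R k\<close> of every degree \<open>k\<close> with \<open>\<parallel>R k\<parallel> = O(\<tau> ^ k)\<close>, and by symmetry
  of \<open>E\<close> they may be taken real. Adding suitable multiples \<open>a k\<close> of \<open>R k\<close> with \<open>|a k| \<le> 1\<close> for \<open>k < n\<close>,
  the coefficients of \<open>R n\<close> become integers, and since \<open>\<tau> > 1\<close> the norm is still \<open>O(n \<tau> ^ n)\<close>.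
\<close>

section \<open>Vandermonde products\<close>

text \<open>This is the leading coefficient of the Lagrange interpolation formula for \<open>P\<close>.\<close>

lemma monic_divided_difference:
  fixes P :: "'a::field poly"
  assumes A: "finite A" "card A = Suc (degree P)" and P: "lead_coeff P = 1"
  shows "(\<Sum>a\<in>A. poly P a / (\<Prod>b\<in>A-{a}. a - b)) = 1"
proof -
  define L where "L a = (\<Prod>b\<in>A-{a}. [:-b, 1:])" for a
  define Q where "Q = (\<Sum>a\<in>A. smult (poly P a / (\<Prod>b\<in>A-{a}. a - b)) (L a))"
  have deg: "degree (L a) = degree P" if "a \<in> A" for a
    unfolding L_def using A that by (subst degree_prod_eq_sum_degree) auto
  have coeff: "coeff (L a) (degree P) = 1" if "a \<in> A" for a
    using lead_coeff_prod[of "\<lambda>b. [:-b, 1:]" "A-{a}"] deg[OF that] by (simp add: L_def)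
  have nz: "(\<Prod>b\<in>A-{a}. a - b) \<noteq> 0" for a
    using A by (subst prod_zero_iff) auto
  have L_poly: "poly (L a) x = (if x = a then (\<Prod>b\<in>A-{a}. a - b) else 0)" if "x \<in> A" for a x
    using A that by (auto simp: L_def poly_prod)
  have "Q = P"
  proof (rule poly_eqI_degree[where A = A])
    fix x assume "x \<in> A"
    then show "poly Q x = poly P x"
      using A nz by (simp add: Q_def poly_sum L_poly if_distrib[where f = "\<lambda>t. _ * t"] cong: if_cong)
  next
    have "degree Q \<le> degree P"
      unfolding Q_def using deg by (intro degree_sum_le A) (auto intro: order.trans[OF degree_smult_le])
    then show "degree Q < card A" "degree P < card A" using A by auto
  qed
  then have "coeff Q (degree P) = 1" using P by simp
  then show ?thesis
    by (simp add: Q_def coeff_sum coeff)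
qed

text \<open>The square root is there because every unordered pair occurs twice in the product.\<close>

definition abs_vandermonde :: "'a::metric_space set \<Rightarrow> real" where
  "abs_vandermonde A = sqrt (\<Prod>a\<in>A. \<Prod>b\<in>A-{a}. dist a b)"

lemma abs_vandermonde_nonneg: "0 \<le> abs_vandermonde A"
  by (auto simp: abs_vandermonde_def intro!: prod_nonneg)

lemma abs_vandermonde_pos: "0 < abs_vandermonde A"
  by (cases "finite A") (auto simp: abs_vandermonde_def intro!: prod_pos)

text \<open>The distances from \<open>a\<close> occur in its own row and once in every other row,
  hence squared; the square root undoes this.\<close>

lemma abs_vandermonde_remove:
  assumes "finite A" "a \<in> A"
  shows "abs_vandermonde A = abs_vandermonde (A - {a}) * (\<Prod>b\<in>A-{a}. dist a b)"
proof -
  have "(\<Prod>x\<in>A. \<Prod>b\<in>A-{x}. dist x b)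
      = (\<Prod>b\<in>A-{a}. dist a b) * (\<Prod>x\<in>A-{a}. \<Prod>b\<in>A-{x}. dist x b)"
    using assms by (simp add: prod.remove[of A a])
  also have "(\<Prod>x\<in>A-{a}. \<Prod>b\<in>A-{x}. dist x b)
      = (\<Prod>x\<in>A-{a}. dist x a * (\<Prod>b\<in>A-{a}-{x}. dist x b))"
  proof (rule prod.cong[OF refl])
    fix x assume "x \<in> A - {a}"
    then have "a \<in> A - {x}" "A - {x} - {a} = A - {a} - {x}" using assms by auto
    then show "(\<Prod>b\<in>A-{x}. dist x b) = dist x a * (\<Prod>b\<in>A-{a}-{x}. dist x b)"
      using assms by (simp add: prod.remove[of "A-{x}" a])
  qed
  also have "(\<Prod>b\<in>A-{a}. dist a b) * \<dots>
      = (\<Prod>x\<in>A-{a}. \<Prod>b\<in>A-{a}-{x}. dist x b) * (\<Prod>b\<in>A-{a}. dist a b)^2"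
    by (simp add: prod.distrib power2_eq_square dist_commute)
  finally show ?thesis
    by (simp add: abs_vandermonde_def real_sqrt_mult prod_nonneg)
qed

text \<open>Induction on the number of points. The divided difference identity for
  \<open>T m\<close> at \<open>m + 1\<close> points is multiplied by the Vandermonde product of
  \<open>A\<close>; each summand then becomes at most \<open>t m\<close> times the product for the
  \<open>m\<close> remaining points. The factor \<open>Suc k\<close> counts these summands.\<close>

lemma abs_vandermonde_le_prod_chebyshev:
  fixes T :: "nat \<Rightarrow> complex poly"
  assumes T: "\<And>k. degree (T k) = k" "\<And>k. lead_coeff (T k) = 1"
    and t: "\<And>k z. z \<in> E \<Longrightarrow> cmod (poly (T k) z) \<le> t k"
  shows "finite A \<Longrightarrow> A \<subseteq> E \<Longrightarrow> abs_vandermonde A \<le> (\<Prod>k<card A. real (Suc k) * t k)"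
proof (induction "card A" arbitrary: A)
  case 0
  then show ?case by (simp add: abs_vandermonde_def)
next
  case (Suc m)
  define W where "W = (\<Prod>k<m. real (Suc k) * t k)"
  have IH: "abs_vandermonde (A - {a}) \<le> W" if "a \<in> A" for a
  proof -
    have m: "m = card (A - {a})" using Suc.hyps(2) Suc.prems that by simp
    then show ?thesis
      using Suc.hyps(1)[OF m] Suc.prems unfolding W_def m[symmetric] by auto
  qed
  have "A \<noteq> {}" using Suc.hyps(2) by auto
  then have t0: "0 \<le> t m"
    using Suc.prems(2) order.trans[OF norm_ge_zero t[of _ m]] by blast
  have "(\<Sum>a\<in>A. poly (T m) a / (\<Prod>b\<in>A-{a}. a - b)) = 1"
    using Suc.prems Suc.hyps(2) T by (intro monic_divided_difference) auto
  then have "1 = cmod (\<Sum>a\<in>A. poly (T m) a / (\<Prod>b\<in>A-{a}. a - b))"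
    by simp
  also have "\<dots> \<le> (\<Sum>a\<in>A. cmod (poly (T m) a / (\<Prod>b\<in>A-{a}. a - b)))"
    by (rule norm_sum)
  also have "\<dots> \<le> (\<Sum>a\<in>A. t m / (\<Prod>b\<in>A-{a}. dist a b))"
    using Suc.prems(2) t
    by (intro sum_mono) (auto simp: norm_divide prod_norm[symmetric] dist_norm intro!: divide_right_mono prod_nonneg)
  finally have "abs_vandermonde A \<le> abs_vandermonde A * (\<Sum>a\<in>A. t m / (\<Prod>b\<in>A-{a}. dist a b))"
    using mult_left_mono[OF _ abs_vandermonde_nonneg, of 1] by simp
  also have "\<dots> = (\<Sum>a\<in>A. t m * abs_vandermonde (A - {a}))"
    unfolding sum_distrib_left
  proof (rule sum.cong[OF refl])
    fix a assume a: "a \<in> A"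
    have "(\<Prod>b\<in>A-{a}. dist a b) \<noteq> 0" using Suc.prems by (subst prod_zero_iff) auto
    then show "abs_vandermonde A * (t m / (\<Prod>b\<in>A-{a}. dist a b)) = t m * abs_vandermonde (A - {a})"
      using abs_vandermonde_remove[OF Suc.prems(1) a] by simp
  qed
  also have "\<dots> \<le> (\<Sum>a\<in>A. t m * W)"
    using t0 IH by (intro sum_mono mult_left_mono) auto
  also have "\<dots> = (\<Prod>k<card A. real (Suc k) * t k)"
    using Suc.hyps(2)[symmetric] by (simp add: W_def)
  finally show ?case .
qed

section \<open>Sums of a kernel over pairs of points\<close>

text \<open>Lists, unlike sets, may repeat points, as tuples drawn from a measure with atoms do, and
  they suit integration over one point at a time.\<close>

fun pair_sum :: "('a \<Rightarrow> 'a \<Rightarrow> real) \<Rightarrow> 'a list \<Rightarrow> real" where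
  "pair_sum K [] = 0"
| "pair_sum K (x # xs) = (\<Sum>y\<leftarrow>xs. K x y) + pair_sum K xs"

lemma pair_sum_ln_dist:
  "distinct xs \<Longrightarrow> pair_sum (\<lambda>x y. ln (dist x y)) xs = ln (abs_vandermonde (set xs))"
proof (induction xs)
  case Nil
  then show ?case by (simp add: abs_vandermonde_def)
next
  case (Cons x xs)
  have "(\<Sum>y\<leftarrow>xs. ln (dist x y)) = (\<Sum>y\<in>set xs. ln (dist x y))"
    using Cons.prems by (simp add: sum_list_distinct_conv_sum_set)
  also have "\<dots> = ln (\<Prod>y\<in>set xs. dist x y)"
    using Cons.prems by (subst ln_prod) auto
  finally show ?case
    using Cons abs_vandermonde_remove[of "set (x # xs)" x] abs_vandermonde_pos[of "set xs"]
    by (simp add: ln_mult prod_pos)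
qed

text \<open>The square of the length is a crude count of the pairs. The loss is harmless, since it
  only influences how small a truncation level is chosen later.\<close>

lemma pair_sum_lower:
  assumes "\<And>x y. x \<in> set xs \<Longrightarrow> y \<in> set xs \<Longrightarrow> - l \<le> K x y" "0 \<le> l"
  shows "- (real (length xs))\<^sup>2 * l \<le> pair_sum K xs"
  using assms(1)
proof (induction xs)
  case (Cons x xs)
  have "(\<Sum>y\<leftarrow>xs. - l) \<le> (\<Sum>y\<leftarrow>xs. K x y)"
    using Cons.prems by (intro sum_list_mono) auto
  then have "- (real (length xs) * l) \<le> (\<Sum>y\<leftarrow>xs. K x y)"
    by (simp add: sum_list_triv)
  moreover have "- (real (length xs))\<^sup>2 * l \<le> pair_sum K xs"
    using Cons by auto
  moreover have "0 \<le> real (length xs) * l" using assms(2) by auto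
  moreover have "(real (length (x # xs)))\<^sup>2 * l = (real (length xs))\<^sup>2 * l + 2 * (real (length xs) * l) + l"
    by (simp add: power2_eq_square algebra_simps)
  ultimately show ?case using assms(2) unfolding pair_sum.simps by linarith
qed simp

text \<open>A single truncated pair already makes the sum large, so that a Vandermonde bound for the
  unbounded kernel passes to a truncated one.\<close>

lemma pair_sum_lower_big_pair:
  assumes "\<And>x y. x \<in> set xs \<Longrightarrow> y \<in> set xs \<Longrightarrow> - l \<le> K x y" "0 \<le> l"
    and "\<not> sorted_wrt (\<lambda>x y. K x y < b) xs"
  shows "b - (real (length xs))\<^sup>2 * l \<le> pair_sum K xs"
  using assms(1,3)
proof (induction xs)
  case (Cons x xs)
  have "(\<Sum>y\<leftarrow>xs. - l) \<le> (\<Sum>y\<leftarrow>xs. K x y)"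
    using Cons.prems by (intro sum_list_mono) auto
  then have row: "- (real (length xs) * l) \<le> (\<Sum>y\<leftarrow>xs. K x y)"
    by (simp add: sum_list_triv)
  have len: "0 \<le> real (length xs) * l" using assms(2) by auto
  have sq: "(real (length (x # xs)))\<^sup>2 * l = (real (length xs))\<^sup>2 * l + 2 * (real (length xs) * l) + l"
    by (simp add: power2_eq_square algebra_simps)
  show ?case
  proof (cases "sorted_wrt (\<lambda>x y. K x y < b) xs")
    case False
    then have "b - (real (length xs))\<^sup>2 * l \<le> pair_sum K xs" using Cons by auto
    then show ?thesis using row assms(2) len sq unfolding pair_sum.simps by linarith
  next
    case True
    then obtain y where y: "y \<in> set xs" "b \<le> K x y" using Cons.prems by force
    have "(\<Sum>z\<leftarrow>remove1 y xs. - l) \<le> (\<Sum>z\<leftarrow>remove1 y xs. K x z)"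
      using Cons.prems(1) by (intro sum_list_mono) (auto dest: notin_set_remove1)
    moreover have "(\<Sum>z\<leftarrow>xs. K x z) = K x y + (\<Sum>z\<leftarrow>remove1 y xs. K x z)"
      using y by (intro sum_list_map_remove1)
    moreover have "real (length (remove1 y xs)) = real (length xs) - 1"
      using y by (auto simp: length_remove1 of_nat_diff Suc_leI dest: length_pos_if_in_set)
    ultimately have "b - real (length xs) * l \<le> (\<Sum>z\<leftarrow>xs. K x z)"
      using y assms(2) by (simp add: sum_list_triv algebra_simps)
    moreover have "- (real (length xs))\<^sup>2 * l \<le> pair_sum K xs"
      using Cons.prems(1) assms(2) by (intro pair_sum_lower) auto
    ultimately show ?thesis using assms(2) len sq unfolding pair_sum.simps by linarith
  qed
qed simp

text \<open>The points are integrated out one at a time; each step replaces the kernel by its potential \<open>U\<close>,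
  and finally by the energy.\<close>

lemma integral_pair_sum_lower:
  fixes K :: "'a \<Rightarrow> 'a \<Rightarrow> real"
  assumes "prob_space \<mu>" and E: "AE x in \<mu>. x \<in> E"
    and K: "case_prod K \<in> borel_measurable (\<mu> \<Otimes>\<^sub>M \<mu>)" "\<And>x y. \<bar>K x y\<bar> \<le> c" "\<And>x y. K x y = K y x"
    and B: "\<And>xs. length xs = m \<Longrightarrow> set xs \<subseteq> E \<Longrightarrow> B \<le> pair_sum K xs"
  shows "B \<le> real m * (real m - 1) / 2 * (\<integral>x. \<integral>y. K x y \<partial>\<mu> \<partial>\<mu>)"
proof -
  interpret prob_space \<mu> by fact
  interpret P: pair_sigma_finite \<mu> \<mu> ..
  define U where "U x = (\<integral>y. K x y \<partial>\<mu>)" for x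
  define I where "I = (\<integral>x. U x \<partial>\<mu>)"
  have K1: "(\<lambda>x. K x y) \<in> borel_measurable \<mu>" if "y \<in> space \<mu>" for y
    using measurable_compose[OF _ K(1), of "\<lambda>x. (x, y)"] that by simp
  have intK: "integrable \<mu> (\<lambda>x. K x y)" if "y \<in> space \<mu>" for y
    using K1[OF that] K(2) by (intro integrable_const_bound[where B = c]) auto
  have U: "U \<in> borel_measurable \<mu>"
    unfolding U_def using K(1) by (rule borel_measurable_lebesgue_integral)
  have Ub: "\<bar>U x\<bar> \<le> c" if "x \<in> space \<mu>" for x
  proof -
    have "(\<lambda>y. K y x) = K x" using K(3) by blast
    then have i: "integrable \<mu> (K x)" using intK[OF that] by simp
    have "- c \<le> K x y" "K x y \<le> c" for y using K(2)[of x y] by linarith+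
    then have "U x \<le> c" "- c \<le> U x"
      unfolding U_def using i by (auto intro!: integral_le_const integral_ge_const)
    then show ?thesis by linarith
  qed
  have intU: "integrable \<mu> U"
    using U Ub by (intro integrable_const_bound[where B = c]) auto
  \<comment> \<open>Generalization for the induction: \<open>k\<close> points have been integrated
    out and those in \<open>xs\<close> remain. Each remaining point meets the \<open>k\<close>
    others through \<open>U\<close>, and the \<open>k (k - 1) / 2\<close> pairs among the latter
    contribute \<open>I\<close> each.\<close>
  have "\<And>xs. length xs + k = m \<Longrightarrow> set xs \<subseteq> E \<inter> space \<mu> \<Longrightarrow>
      B \<le> pair_sum K xs + real k * (\<Sum>x\<leftarrow>xs. U x) + real k * (real k - 1) / 2 * I" for k
  proof (induction k)
    case 0
    then show ?case using B by auto
  next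
    case (Suc k)
    have int_row: "integrable \<mu> (\<lambda>x. \<Sum>y\<leftarrow>xs. K x y) \<and> (\<integral>x. (\<Sum>y\<leftarrow>xs. K x y) \<partial>\<mu>) = (\<Sum>y\<leftarrow>xs. U y)"
      using Suc.prems(2)
    proof (induction xs)
      case (Cons a xs)
      then show ?case using intK[of a] by (auto simp: U_def K(3)[of _ a])
    qed auto
    have "AE x in \<mu>. B \<le> pair_sum K (x # xs) + real k * (\<Sum>x\<leftarrow>x # xs. U x) + real k * (real k - 1) / 2 * I"
      using E AE_space
    proof eventually_elim
      case (elim x)
      then show ?case using Suc.prems by (intro Suc.IH) auto
    qed
    then have "(\<integral>x. B \<partial>\<mu>) \<le> (\<integral>x. (\<Sum>y\<leftarrow>xs. K x y) + (real k * U x +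
        (pair_sum K xs + real k * (\<Sum>x\<leftarrow>xs. U x) + real k * (real k - 1) / 2 * I)) \<partial>\<mu>)"
      using int_row intU by (intro integral_mono_AE) (auto simp: algebra_simps)
    also have "\<dots> = (\<Sum>y\<leftarrow>xs. U y) + (real k * I +
        (pair_sum K xs + real k * (\<Sum>x\<leftarrow>xs. U x) + real k * (real k - 1) / 2 * I))"
      using int_row intU by (simp add: prob_space I_def)
    finally show ?case
      by (simp add: prob_space field_simps)
  qed
  from this[of "[]" m] show ?thesis
    by (simp add: I_def U_def)
qed

section \<open>Rounding monic polynomials to integer coefficients\<close>

text \<open>With \<open>j = k mod n\<close> and \<open>q = k div n\<close>, a single monic
  polynomial of degree \<open>n\<close> yields monic polynomials of every degree
  \<open>k\<close>.\<close>

lemma degree_lead_coeff_monom_mult_power: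
  fixes P :: "'a::idom poly"
  assumes "degree P = n" "lead_coeff P = 1"
  shows "degree (monom 1 j * P ^ q) = j + n * q" "lead_coeff (monom 1 j * P ^ q) = 1"
proof -
  have "P \<noteq> 0" using assms(2) by auto
  then show "degree (monom 1 j * P ^ q) = j + n * q"
    using assms by (simp add: degree_mult_eq degree_power_eq degree_monom_eq mult.commute monom_eq_0_iff)
  show "lead_coeff (monom 1 j * P ^ q) = 1"
    unfolding lead_coeff_mult lead_coeff_power using assms by (simp add: degree_monom_eq)
qed

text \<open>The factor \<open>\<rho> ^ n\<close> is independent of \<open>j\<close> and
  \<open>q\<close>, so passing to degrees that are not multiples of \<open>n\<close> costs only a
  constant.\<close>

lemma norm_monom_mult_power_le:
  fixes P :: "complex poly"
  assumes "cmod z \<le> \<rho>" "1 \<le> \<rho>" "cmod (poly P z) \<le> M" "j \<le> n"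
  shows "cmod (poly (monom 1 j * P ^ q) z) \<le> \<rho> ^ n * M ^ q"
proof -
  have "cmod z ^ j \<le> \<rho> ^ j" using assms by (intro power_mono) auto
  also have "\<dots> \<le> \<rho> ^ n" using assms by (intro power_increasing)
  finally show ?thesis
    using assms by (auto simp: norm_mult norm_power poly_monom intro!: mult_mono power_mono)
qed

text \<open>Taking real parts of the coefficients averages \<open>P\<close> with the polynomial of
  conjugate coefficients. The latter has at \<open>z\<close> the conjugate of the value of
  \<open>P\<close> at \<open>cnj z\<close>, which is again a point of \<open>E\<close>.\<close>

lemma real_coeff_poly_of_symmetric:
  fixes P :: "complex poly"
  assumes sym: "\<And>z. z \<in> E \<Longrightarrow> cnj z \<in> E"
    and P: "lead_coeff P = 1" and M: "\<And>z. z \<in> E \<Longrightarrow> cmod (poly P z) \<le> M"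
  obtains R where "degree R = degree P" "lead_coeff R = 1" "\<And>i. coeff R i \<in> \<real>"
    "\<And>z. z \<in> E \<Longrightarrow> cmod (poly R z) \<le> M"
proof
  define R where "R = map_poly (\<lambda>c. complex_of_real (Re c)) P"
  have c: "coeff R i = complex_of_real (Re (coeff P i))" for i
    by (simp add: R_def coeff_map_poly)
  show deg: "degree R = degree P"
    unfolding R_def using P by (intro map_poly_degree_eq) simp
  show "lead_coeff R = 1" "\<And>i. coeff R i \<in> \<real>" using P by (simp_all add: c deg)
  show "cmod (poly R z) \<le> M" if "z \<in> E" for z
  proof -
    have "2 * poly R z = poly P z + cnj (poly P (cnj z))"
      by (simp add: poly_altdef deg c sum_distrib_left sum.distrib[symmetric] distrib_right[symmetric]
          complex_add_cnj mult.assoc[symmetric])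
    then have "2 * cmod (poly R z) = cmod (poly P z + cnj (poly P (cnj z)))"
      by (metis norm_mult norm_numeral)
    also have "\<dots> \<le> cmod (poly P z) + cmod (poly P (cnj z))"
      by (metis norm_triangle_ineq complex_mod_cnj)
    also have "\<dots> \<le> M + M" using M sym that by (intro add_mono) auto
    finally show ?thesis by simp
  qed
qed

text \<open>The coefficients are corrected from the top down: adding a multiple of \<open>R k\<close> leaves those of
  index above \<open>k\<close> unchanged.\<close>

lemma exists_integral_lower_coeffs:
  fixes R :: "nat \<Rightarrow> complex poly"
  assumes R: "\<And>k. degree (R k) = k" "\<And>k. lead_coeff (R k) = 1" "\<And>k i. coeff (R k) i \<in> \<real>"
  shows "(\<And>i. coeff F i \<in> \<real>) \<Longrightarrow> \<exists>a :: nat \<Rightarrow> real. (\<forall>k. \<bar>a k\<bar> \<le> 1) \<and>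
    (\<forall>i<n. coeff (F + (\<Sum>k<n. smult (of_real (a k)) (R k))) i \<in> \<int>)"
proof (induction n arbitrary: F)
  case 0
  show ?case by (intro exI[of _ "\<lambda>_. 0"]) auto
next
  case (Suc n)
  define b where "b = of_int (round (Re (coeff F n))) - Re (coeff F n)"
  define G where "G = F + smult (of_real b) (R n)"
  have "coeff G i \<in> \<real>" for i using Suc.prems R(3) by (auto simp: G_def)
  then obtain a where a: "\<forall>k. \<bar>a k\<bar> \<le> 1"
    "\<forall>i<n. coeff (G + (\<Sum>k<n. smult (of_real (a k)) (R k))) i \<in> \<int>"
    using Suc.IH by blast
  define a' where "a' = a(n := b)"
  have eq: "F + (\<Sum>k<Suc n. smult (of_real (a' k)) (R k)) = G + (\<Sum>k<n. smult (of_real (a k)) (R k))"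
    by (simp add: G_def a'_def)
  have "coeff (\<Sum>k<n. smult (of_real (a k)) (R k)) n = 0"
    using R(1) by (simp add: coeff_sum coeff_eq_0)
  moreover have "coeff (R n) n = 1" using R(1,2)[of n] by simp
  moreover have "coeff F n = of_real (Re (coeff F n))" using Suc.prems by (simp add: complex_is_Real_iff complex_eq_iff)
  ultimately have "coeff (G + (\<Sum>k<n. smult (of_real (a k)) (R k))) n = of_int (round (Re (coeff F n)))"
    by (simp add: G_def b_def)
  then have "\<forall>i<Suc n. coeff (F + (\<Sum>k<Suc n. smult (of_real (a' k)) (R k))) i \<in> \<int>"
    unfolding eq using a(2) by (auto simp: less_Suc_eq)
  moreover have "\<forall>k. \<bar>a' k\<bar> \<le> 1"
    using a(1) of_int_round_abs_le[of "Re (coeff F n)"] by (auto simp: a'_def b_def)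
  ultimately show ?case by blast
qed

text \<open>The rounding starts from \<open>R n\<close> and touches only coefficients below
  \<open>n\<close>, so the result stays monic of degree \<open>n\<close>. As the multipliers are at
  most 1 in absolute value, the bounds simply add up.\<close>

lemma exists_monic_int_poly_le:
  fixes R :: "nat \<Rightarrow> complex poly"
  assumes R: "\<And>k. degree (R k) = k" "\<And>k. lead_coeff (R k) = 1" "\<And>k i. coeff (R k) i \<in> \<real>"
    and t: "\<And>k z. z \<in> E \<Longrightarrow> cmod (poly (R k) z) \<le> t k"
  obtains Q where "Q \<in> monic_int_polys n"
    "\<And>z. z \<in> E \<Longrightarrow> cmod (poly (map_poly of_int Q) z) \<le> (\<Sum>k\<le>n. t k)"
proof -
  obtain a :: "nat \<Rightarrow> real" where a: "\<forall>k. \<bar>a k\<bar> \<le> 1"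
    "\<forall>i<n. coeff (R n + (\<Sum>k<n. smult (of_real (a k)) (R k))) i \<in> \<int>"
    using exists_integral_lower_coeffs[of R "R n" n, OF R R(3)] by blast
  define G where "G = R n + (\<Sum>k<n. smult (of_real (a k)) (R k))"
  \<comment> \<open>The coefficients of \<open>G\<close> are already integers; the floor of the real
    part only changes their type.\<close>
  define Q where "Q = map_poly (\<lambda>c. \<lfloor>Re c\<rfloor>) G"
  have low: "coeff (\<Sum>k<n. smult (of_real (a k)) (R k)) i = 0" if "n \<le> i" for i
    using R(1) that by (simp add: coeff_sum coeff_eq_0)
  have Gn: "coeff G n = 1" using R(1,2)[of n] by (simp add: G_def low)
  have Gi: "coeff G i = 0" if "i > n" for i
    using R(1)[of n] that by (simp add: G_def low coeff_eq_0)
  have int: "coeff G i \<in> \<int>" for i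
    using a(2) Gn Gi[of i] by (cases "i < n"; cases "i = n") (auto simp: G_def[symmetric])
  have GQ: "coeff G i = of_int (coeff Q i)" for i
  proof -
    obtain m where "coeff G i = of_int m" using int by (rule Ints_cases)
    then show ?thesis by (simp add: Q_def coeff_map_poly)
  qed
  then have G: "map_poly of_int Q = G" by (intro poly_eqI) (simp add: coeff_map_poly)
  have "coeff Q n = 1" "\<And>i. i > n \<Longrightarrow> coeff Q i = 0" using GQ Gn Gi by auto
  then have "degree Q = n"
    by (metis le_degree degree_le less_one order_antisym zero_neq_one)
  then have "Q \<in> monic_int_polys n" using \<open>coeff Q n = 1\<close> by (simp add: monic_int_polys_def)
  moreover have "cmod (poly (map_poly of_int Q) z) \<le> (\<Sum>k\<le>n. t k)" if z: "z \<in> E" for z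
  proof -
    have "cmod (poly G z) \<le> cmod (poly (R n) z) + cmod (\<Sum>k<n. of_real (a k) * poly (R k) z)"
      by (simp add: G_def poly_sum norm_triangle_ineq)
    also have "cmod (\<Sum>k<n. of_real (a k) * poly (R k) z) \<le> (\<Sum>k<n. \<bar>a k\<bar> * cmod (poly (R k) z))"
      by (rule order.trans[OF norm_sum]) (simp add: norm_mult)
    also have "\<dots> \<le> (\<Sum>k<n. 1 * t k)"
      using a(1) t[OF z] by (intro sum_mono mult_mono) auto
    also have "cmod (poly (R n) z) \<le> t n" by (rule t[OF z])
    finally show ?thesis by (simp add: G lessThan_Suc_atMost[symmetric])
  qed
  ultimately show ?thesis using that by blast
qed

text \<open>Because \<open>1 \<le> \<tau>\<close>, the last of the bounds \<open>\<tau> ^ k\<close>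
  is the largest, and rounding costs no more than the factor \<open>n + 1\<close>, which disappears
  under the \<open>n\<close>-th root.\<close>

lemma exists_monic_int_polys_geometric:
  fixes P :: "complex poly"
  assumes E: "bounded E" and sym: "\<And>z. z \<in> E \<Longrightarrow> cnj z \<in> E"
    and P: "degree P = d" "0 < d" "lead_coeff P = 1"
    and \<tau>: "1 \<le> \<tau>" "\<And>z. z \<in> E \<Longrightarrow> cmod (poly P z) \<le> \<tau> ^ d"
  obtains C where "0 < C" "\<And>n. \<exists>Q\<in>monic_int_polys n. \<forall>z\<in>E.
    cmod (poly (map_poly of_int Q) z) \<le> C * real (Suc n) * \<tau> ^ n"
proof -
  obtain \<rho>' where "\<And>z. z \<in> E \<Longrightarrow> cmod z \<le> \<rho>'" using E by (auto simp: bounded_iff)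
  then obtain \<rho> where \<rho>: "1 \<le> \<rho>" "\<And>z. z \<in> E \<Longrightarrow> cmod z \<le> \<rho>"
    by (metis max.cobounded1 max.coboundedI2)
  have "\<exists>R. degree R = k \<and> lead_coeff R = 1 \<and> (\<forall>i. coeff R i \<in> \<real>) \<and>
      (\<forall>z\<in>E. cmod (poly R z) \<le> \<rho> ^ d * \<tau> ^ k)" for k
  proof -
    define T where "T = monom 1 (k mod d) * P ^ (k div d)"
    have T: "degree T = k" "lead_coeff T = 1"
      using degree_lead_coeff_monom_mult_power[OF P(1,3), of "k mod d" "k div d"] by (simp_all add: T_def)
    have "cmod (poly T z) \<le> \<rho> ^ d * \<tau> ^ k" if "z \<in> E" for z
    proof -
      have "cmod (poly T z) \<le> \<rho> ^ d * (\<tau> ^ d) ^ (k div d)"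
        unfolding T_def using \<rho> \<tau> that P(2) by (intro norm_monom_mult_power_le) (auto simp: less_imp_le)
      also have "(\<tau> ^ d) ^ (k div d) \<le> \<tau> ^ k"
        using \<tau>(1) by (auto simp: power_mult[symmetric] intro!: power_increasing)
      finally show ?thesis using \<rho>(1) by (simp add: mult_left_mono)
    qed
    then show ?thesis
      using real_coeff_poly_of_symmetric[OF sym T(2)] T by metis
  qed
  then obtain R where R: "\<And>k. degree (R k) = k" "\<And>k. lead_coeff (R k) = 1" "\<And>k i. coeff (R k) i \<in> \<real>"
    "\<And>k z. z \<in> E \<Longrightarrow> cmod (poly (R k) z) \<le> \<rho> ^ d * \<tau> ^ k"
    by metis
  show ?thesis
  proof (rule that)
    show "0 < \<rho> ^ d" using \<rho>(1) by simp
    fix n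
    obtain Q where Q: "Q \<in> monic_int_polys n"
      "\<And>z. z \<in> E \<Longrightarrow> cmod (poly (map_poly of_int Q) z) \<le> (\<Sum>k\<le>n. \<rho> ^ d * \<tau> ^ k)"
      using exists_monic_int_poly_le[OF R] by blast
    have "(\<Sum>k\<le>n. \<rho> ^ d * \<tau> ^ k) \<le> (\<Sum>k\<le>n. \<rho> ^ d * \<tau> ^ n)"
      using \<rho>(1) \<tau>(1) by (intro sum_mono mult_left_mono power_increasing) auto
    also have "\<dots> = \<rho> ^ d * real (Suc n) * \<tau> ^ n" by simp
    finally show "\<exists>Q\<in>monic_int_polys n. \<forall>z\<in>E.
        cmod (poly (map_poly of_int Q) z) \<le> \<rho> ^ d * real (Suc n) * \<tau> ^ n"
      using Q by (intro bexI[of _ Q]) (auto intro: order.trans)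
  qed
qed

section \<open>Truncated logarithmic energy\<close>

text \<open>For \<open>0 < e\<close> the lower cutoff makes the kernel finite and continuous across
  the diagonal. The upper cutoff has no effect on a set of diameter at most \<open>R\<close>, but
  makes the kernel bounded on the whole plane.\<close>

definition trunc_log_kernel :: "real \<Rightarrow> real \<Rightarrow> complex \<Rightarrow> complex \<Rightarrow> real" where
  "trunc_log_kernel e R z w = - ln (max e (min R (dist z w)))"

lemma trunc_log_kernel_commute: "trunc_log_kernel e R z w = trunc_log_kernel e R w z"
  by (simp add: trunc_log_kernel_def dist_commute)

lemma continuous_on_trunc_log_kernel:
  "0 < e \<Longrightarrow> continuous_on UNIV (case_prod (trunc_log_kernel e R))"
  unfolding trunc_log_kernel_def case_prod_unfold by (intro continuous_intros) auto

lemma measurable_trunc_log_kernel [measurable]: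
  "0 < e \<Longrightarrow> case_prod (trunc_log_kernel e R) \<in> borel_measurable (borel \<Otimes>\<^sub>M borel)"
  unfolding borel_prod by (intro borel_measurable_continuous_onI continuous_on_trunc_log_kernel)

lemma trunc_log_kernel_bounds:
  assumes "0 < e" "e \<le> R"
  shows "- ln R \<le> trunc_log_kernel e R z w" "trunc_log_kernel e R z w \<le> - ln e"
  using assms by (auto simp: trunc_log_kernel_def)

lemma abs_trunc_log_kernel_le:
  assumes "0 < e" "e \<le> R"
  shows "\<bar>trunc_log_kernel e R z w\<bar> \<le> \<bar>ln R\<bar> + \<bar>ln e\<bar>"
  using trunc_log_kernel_bounds[OF assms, of z w] by linarith

lemma trunc_log_kernel_eq:
  "0 < e \<Longrightarrow> e \<le> dist z w \<Longrightarrow> dist z w \<le> R \<Longrightarrow> trunc_log_kernel e R z w = - ln (dist z w)"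
  by (simp add: trunc_log_kernel_def)

lemma log_kernel_eq: "z \<noteq> w \<Longrightarrow> log_kernel z w = ereal (- ln (dist z w))"
  by (simp add: log_kernel_def dist_norm ln_div)

text \<open>The negative part of the kernel lives at distances above 1, where a cutoff at
  \<open>e \<le> 1\<close> changes nothing.\<close>

lemma e2ennreal_uminus_log_kernel:
  assumes "0 < e" "e \<le> 1" "1 \<le> R" "dist z w \<le> R"
  shows "e2ennreal (- log_kernel z w) = ennreal (- trunc_log_kernel e R z w)"
proof (cases "e \<le> dist z w")
  case True
  then have "z \<noteq> w" using assms by auto
  then show ?thesis using True assms by (simp add: log_kernel_eq trunc_log_kernel_eq e2ennreal_ereal)
next
  case False
  then have "- trunc_log_kernel e R z w \<le> 0" using assms by (simp add: trunc_log_kernel_def)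
  moreover have "- log_kernel z w \<le> 0"
    using False assms by (cases "z = w") (auto simp: log_kernel_eq, simp add: log_kernel_def)
  ultimately show ?thesis by (simp add: e2ennreal_neg ennreal_neg)
qed

text \<open>Preparation for monotone convergence of the positive parts: off the diagonal the
  truncations are eventually exact, and on it they equal \<open>ln (n + 1)\<close> and grow to
  infinity.\<close>

lemma e2ennreal_log_kernel:
  assumes "1 \<le> R" "dist z w \<le> R"
  shows "e2ennreal (log_kernel z w) = (SUP n. ennreal (trunc_log_kernel (1 / real (Suc n)) R z w))"
proof (cases "z = w")
  case True
  have "(SUP n. ennreal (ln (real (Suc n)))) = \<top>"
  proof (rule ennreal_SUP_eq_top)
    fix n :: nat
    obtain m :: nat where "exp (real n) < real m" using reals_Archimedean2 by blast
    then have "real n \<le> ln (real (Suc m))" by (subst ln_ge_iff) auto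
    then show "\<exists>i\<in>UNIV. of_nat n \<le> ennreal (ln (real (Suc i)))"
      by (intro bexI[of _ m]) (auto simp: ennreal_of_nat_eq_real_of_nat intro: ennreal_leI)
  qed
  moreover have "trunc_log_kernel (1 / real (Suc n)) R z w = ln (real (Suc n))" for n
    using True assms by (simp add: trunc_log_kernel_def ln_div)
  moreover have "e2ennreal (log_kernel z w) = \<top>" using True by (simp add: log_kernel_def)
  ultimately show ?thesis by (simp only:)
next
  case False
  then have d: "0 < dist z w" by simp
  have "(SUP n. ennreal (trunc_log_kernel (1 / real (Suc n)) R z w)) = ennreal (- ln (dist z w))"
  proof (rule antisym)
    show "(SUP n. ennreal (trunc_log_kernel (1 / real (Suc n)) R z w)) \<le> ennreal (- ln (dist z w))"
      using d assms by (intro SUP_least ennreal_leI) (auto simp: trunc_log_kernel_def min_absorb2 intro!: ln_mono)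
    obtain n where "1 / real (Suc n) < dist z w"
      using d reals_Archimedean[OF d] by (auto simp: inverse_eq_divide)
    then have "trunc_log_kernel (1 / real (Suc n)) R z w = - ln (dist z w)"
      using assms by (intro trunc_log_kernel_eq) auto
    then show "ennreal (- ln (dist z w)) \<le> (SUP n. ennreal (trunc_log_kernel (1 / real (Suc n)) R z w))"
      by (intro SUP_upper2[of n]) auto
  qed
  then show ?thesis using False by (simp add: log_kernel_eq e2ennreal_ereal)
qed

text \<open>Reduces the energy to bounded continuous kernels. The negative part is finite and the
  same for all \<open>e\<close>, so only positive parts need comparison: a pointwise bound gives the
  first claim, monotone convergence the second.\<close>

lemma log_energy_truncation:
  assumes \<mu>: "\<mu> \<in> prob_measures_on E" and E: "E \<in> sets borel"
    and R: "1 \<le> R" "\<And>z w. z \<in> E \<Longrightarrow> w \<in> E \<Longrightarrow> dist z w \<le> R"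
  shows log_energy_ge: "\<And>e. 0 < e \<Longrightarrow> e \<le> 1 \<Longrightarrow>
      ereal (\<integral>w. \<integral>z. trunc_log_kernel e R w z \<partial>\<mu> \<partial>\<mu>) \<le> log_energy \<mu>"
    and log_energy_le: "\<And>L. (\<And>e. 0 < e \<Longrightarrow> e \<le> 1 \<Longrightarrow>
        (\<integral>w. \<integral>z. trunc_log_kernel e R w z \<partial>\<mu> \<partial>\<mu>) \<le> L) \<Longrightarrow> log_energy \<mu> \<le> ereal L"
proof -
  interpret prob_space \<mu> using \<mu> by (simp add: prob_measures_on_def)
  interpret P: pair_prob_space \<mu> \<mu> ..
  have [measurable_cong]: "sets \<mu> = sets borel" using \<mu> by (simp add: prob_measures_on_def)
  have AE_E: "AE z in \<mu>. z \<in> E"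
    using \<mu> E by (subst AE_in_set_eq_1) (auto simp: prob_measures_on_def emeasure_eq_measure)
  have nn_mono: "(\<integral>\<^sup>+w. \<integral>\<^sup>+z. f w z \<partial>\<mu> \<partial>\<mu>) \<le> (\<integral>\<^sup>+w. \<integral>\<^sup>+z. g w z \<partial>\<mu> \<partial>\<mu>)"
    if "\<And>w z. w \<in> E \<Longrightarrow> z \<in> E \<Longrightarrow> f w z \<le> g w z" for f g
  proof (rule nn_integral_mono_AE)
    show "AE w in \<mu>. (\<integral>\<^sup>+z. f w z \<partial>\<mu>) \<le> (\<integral>\<^sup>+z. g w z \<partial>\<mu>)"
      using AE_E
    proof eventually_elim
      case w: (elim w)
      show ?case
        by (rule nn_integral_mono_AE, use AE_E in eventually_elim) (rule that[OF w])
    qed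
  qed
  have nn_cong: "(\<integral>\<^sup>+w. \<integral>\<^sup>+z. f w z \<partial>\<mu> \<partial>\<mu>) = (\<integral>\<^sup>+w. \<integral>\<^sup>+z. g w z \<partial>\<mu> \<partial>\<mu>)"
    if "\<And>w z. w \<in> E \<Longrightarrow> z \<in> E \<Longrightarrow> f w z = g w z" for f g
    by (intro antisym nn_mono) (simp_all add: that)
  define p where "p e = (\<integral>\<^sup>+w. \<integral>\<^sup>+z. ennreal (trunc_log_kernel e R w z) \<partial>\<mu> \<partial>\<mu>)" for e
  define q where "q e = (\<integral>\<^sup>+w. \<integral>\<^sup>+z. ennreal (- trunc_log_kernel e R w z) \<partial>\<mu> \<partial>\<mu>)" for e
  define p' where "p' = (\<integral>\<^sup>+w. \<integral>\<^sup>+z. e2ennreal (log_kernel z w) \<partial>\<mu> \<partial>\<mu>)"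
  define q' where "q' = (\<integral>\<^sup>+w. \<integral>\<^sup>+z. e2ennreal (- log_kernel z w) \<partial>\<mu> \<partial>\<mu>)"
  have energy: "log_energy \<mu> = enn2ereal p' - enn2ereal q'"
    by (simp add: log_energy_def p'_def q'_def)
  have fin: "p e < \<top>" "q e < \<top>" if "0 < e" "e \<le> 1" for e
  proof -
    have b: "\<bar>trunc_log_kernel e R w z\<bar> \<le> \<bar>ln R\<bar> + \<bar>ln e\<bar>" for w z
      using that R by (intro abs_trunc_log_kernel_le) auto
    have "p e \<le> (\<integral>\<^sup>+w. \<integral>\<^sup>+z. ennreal (\<bar>ln R\<bar> + \<bar>ln e\<bar>) \<partial>\<mu> \<partial>\<mu>)"
      unfolding p_def using b by (intro nn_integral_mono ennreal_leI) (auto simp: abs_le_iff)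
    then show "p e < \<top>" by (auto simp: emeasure_space_1 intro: le_less_trans)
    have "q e \<le> (\<integral>\<^sup>+w. \<integral>\<^sup>+z. ennreal (\<bar>ln R\<bar> + \<bar>ln e\<bar>) \<partial>\<mu> \<partial>\<mu>)"
      unfolding q_def using b by (intro nn_integral_mono ennreal_leI) (auto simp: abs_le_iff)
    then show "q e < \<top>" by (auto simp: emeasure_space_1 intro: le_less_trans)
  qed
  have q: "q e = q'" if "0 < e" "e \<le> 1" for e
    unfolding q_def q'_def
    by (rule nn_cong) (use R that in \<open>simp add: e2ennreal_uminus_log_kernel[of e R] trunc_log_kernel_commute\<close>)
  have meas: "(\<lambda>z. ennreal (trunc_log_kernel e R w z)) \<in> borel_measurable \<mu>"
    "(\<lambda>w. \<integral>\<^sup>+z. ennreal (trunc_log_kernel e R w z) \<partial>\<mu>) \<in> borel_measurable \<mu>" if "0 < e" for e w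
    using that by measurable
  have mono: "ennreal (trunc_log_kernel (1 / real (Suc m)) R w z) \<le> ennreal (trunc_log_kernel (1 / real (Suc n)) R w z)"
    if "m \<le> n" for m n w z
  proof -
    have "1 / real (Suc n) \<le> 1 / real (Suc m)" using that by (intro frac_le) auto
    then have "ln (max (1 / real (Suc n)) (min R (dist w z))) \<le> ln (max (1 / real (Suc m)) (min R (dist w z)))"
      by (intro ln_mono max.mono) (auto simp: less_max_iff_disj)
    then show ?thesis by (intro ennreal_leI) (simp add: trunc_log_kernel_def)
  qed
  have p': "p' = (SUP n. p (1 / real (Suc n)))"
  proof -
    have "p' = (\<integral>\<^sup>+w. \<integral>\<^sup>+z. (SUP n. ennreal (trunc_log_kernel (1 / real (Suc n)) R w z)) \<partial>\<mu> \<partial>\<mu>)"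
      unfolding p'_def
      by (rule nn_cong) (use R in \<open>simp add: e2ennreal_log_kernel[of R] trunc_log_kernel_commute\<close>)
    also have "\<dots> = (\<integral>\<^sup>+w. (SUP n. \<integral>\<^sup>+z. ennreal (trunc_log_kernel (1 / real (Suc n)) R w z) \<partial>\<mu>) \<partial>\<mu>)"
      by (intro nn_integral_cong nn_integral_monotone_convergence_SUP meas)
        (auto simp: incseq_def le_fun_def mono simp del: of_nat_Suc)
    also have "\<dots> = (SUP n. \<integral>\<^sup>+w. \<integral>\<^sup>+z. ennreal (trunc_log_kernel (1 / real (Suc n)) R w z) \<partial>\<mu> \<partial>\<mu>)"
      by (intro nn_integral_monotone_convergence_SUP meas)
        (auto simp: incseq_def le_fun_def mono simp del: of_nat_Suc intro!: nn_integral_mono)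
    finally show ?thesis by (simp add: p_def)
  qed
  have real: "(\<integral>w. \<integral>z. trunc_log_kernel e R w z \<partial>\<mu> \<partial>\<mu>) = enn2real (p e) - enn2real q'"
    if e: "0 < e" "e \<le> 1" for e
  proof -
    have m[measurable]: "case_prod (trunc_log_kernel e R) \<in> borel_measurable (\<mu> \<Otimes>\<^sub>M \<mu>)"
      using e by measurable
    have "\<bar>trunc_log_kernel e R w z\<bar> \<le> \<bar>ln R\<bar> + \<bar>ln e\<bar>" for w z
      using e R by (intro abs_trunc_log_kernel_le) auto
    then have i: "integrable (\<mu> \<Otimes>\<^sub>M \<mu>) (case_prod (trunc_log_kernel e R))"
      using m by (intro P.integrable_const_bound[where B = "\<bar>ln R\<bar> + \<bar>ln e\<bar>"]) auto
    have "(\<integral>w. \<integral>z. trunc_log_kernel e R w z \<partial>\<mu> \<partial>\<mu>) = integral\<^sup>L (\<mu> \<Otimes>\<^sub>M \<mu>) (case_prod (trunc_log_kernel e R))"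
      using P.integral_fst'[OF i] by simp
    also have "\<dots> = enn2real (\<integral>\<^sup>+x. ennreal (case_prod (trunc_log_kernel e R) x) \<partial>(\<mu> \<Otimes>\<^sub>M \<mu>))
        - enn2real (\<integral>\<^sup>+x. ennreal (- case_prod (trunc_log_kernel e R) x) \<partial>(\<mu> \<Otimes>\<^sub>M \<mu>))"
      by (rule real_lebesgue_integral_def[OF i])
    also have "(\<integral>\<^sup>+x. ennreal (case_prod (trunc_log_kernel e R) x) \<partial>(\<mu> \<Otimes>\<^sub>M \<mu>)) = p e"
      unfolding p_def by (subst nn_integral_fst[symmetric]) auto
    also have "(\<integral>\<^sup>+x. ennreal (- case_prod (trunc_log_kernel e R) x) \<partial>(\<mu> \<Otimes>\<^sub>M \<mu>)) = q e"
      unfolding q_def by (subst nn_integral_fst[symmetric]) auto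
    finally show ?thesis using q[OF e] by simp
  qed
  \<comment> \<open>Finiteness is inherited from the truncated kernel and makes the subtraction in
    \<open>ereal\<close> harmless.\<close>
  have q'_fin: "q' < \<top>" using fin(2)[of 1] q[of 1] by simp
  then have q'_ereal: "enn2ereal q' = ereal (enn2real q')"
    by (cases q') (auto simp: enn2ereal_ennreal)
  have p_ereal: "enn2ereal (p e) = ereal (enn2real (p e))" if "0 < e" "e \<le> 1" for e
    using fin(1)[OF that] by (cases "p e") (auto simp: enn2ereal_ennreal)
  show "ereal (\<integral>w. \<integral>z. trunc_log_kernel e R w z \<partial>\<mu> \<partial>\<mu>) \<le> log_energy \<mu>" if e: "0 < e" "e \<le> 1" for e
  proof -
    have "p e \<le> p'"
      unfolding p_def p'_def
    proof (rule nn_mono)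
      fix w z assume "w \<in> E" "z \<in> E"
      then show "ennreal (trunc_log_kernel e R w z) \<le> e2ennreal (log_kernel z w)"
        using R e by (cases "z = w") (auto simp: log_kernel_eq log_kernel_def[of w w] e2ennreal_ereal
            trunc_log_kernel_def dist_commute intro!: ennreal_leI)
    qed
    then have "enn2ereal (p e) - enn2ereal q' \<le> log_energy \<mu>"
      unfolding energy by (intro ereal_minus_mono) (auto simp: less_eq_ennreal.rep_eq)
    then show ?thesis by (simp add: real[OF e] p_ereal[OF e] q'_ereal)
  qed
  show "log_energy \<mu> \<le> ereal L"
    if L: "\<And>e. 0 < e \<Longrightarrow> e \<le> 1 \<Longrightarrow> (\<integral>w. \<integral>z. trunc_log_kernel e R w z \<partial>\<mu> \<partial>\<mu>) \<le> L" for L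
  proof -
    have pL: "enn2real (p e) \<le> L + enn2real q'" if e: "0 < e" "e \<le> 1" for e
      using L[OF e] real[OF e] by simp
    have "p e \<le> ennreal (L + enn2real q')" if e: "0 < e" "e \<le> 1" for e
      using pL[OF e] fin(1)[OF e] by (metis ennreal_enn2real ennreal_leI)
    then have "p' \<le> ennreal (L + enn2real q')"
      unfolding p' by (intro SUP_least) auto
    \<comment> \<open>For a negative number \<open>ennreal\<close> would return 0 and the bound
      would not translate back to \<open>ereal\<close>.\<close>
    moreover have "0 \<le> L + enn2real q'"
      using pL[of 1] enn2real_nonneg[of "p 1"] by linarith
    ultimately have "enn2ereal p' \<le> ereal (L + enn2real q')"
      by (simp add: less_eq_ennreal.rep_eq enn2ereal_ennreal)
    then have "log_energy \<mu> \<le> ereal (L + enn2real q') - ereal (enn2real q')"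
      unfolding energy q'_ereal by (rule ereal_minus_mono) simp
    then show ?thesis by simp
  qed
qed

section \<open>Lower bounds for the energy\<close>

lemma pair_sum_cong:
  "sorted_wrt (\<lambda>x y. K x y = K' x y) xs \<Longrightarrow> pair_sum K xs = pair_sum K' xs"
proof (induction xs)
  case (Cons x xs)
  have "sum_list (map (K x) xs) = sum_list (map (K' x) xs)"
    using Cons.prems by (auto intro!: arg_cong[of _ _ sum_list])
  then show ?case using Cons by simp
qed simp

lemma pair_sum_uminus: "pair_sum (\<lambda>x y. - K x y) xs = - pair_sum K xs"
  by (induction xs) (simp_all add: uminus_sum_list_map o_def)

text \<open>This is the total exponent of \<open>M\<close> when the polynomials
  \<open>z ^ (k mod n) * P ^ (k div n)\<close> are used for all \<open>k < L * n\<close>; the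
  quotient is constant on blocks of length \<open>n\<close>.\<close>

lemma sum_div_nat:
  assumes "0 < n"
  shows "(\<Sum>k<L*n. real (k div n)) = real n * real L * (real L - 1) / 2"
proof -
  have "(\<Sum>k<L*n. real (k div n)) = (\<Sum>i<L. \<Sum>k=i*n..<i*n+n. real (k div n))"
    by (rule sum.nat_group[symmetric])
  also have "\<dots> = (\<Sum>i<L. \<Sum>k=i*n..<i*n+n. real i)"
  proof (intro sum.cong refl arg_cong[of _ _ real])
    fix i k assume "k \<in> {i * n..<i * n + n}"
    then have "n * i \<le> k" "k < n * Suc i" by (simp_all add: mult.commute)
    then show "k div n = i" by (rule div_nat_eqI)
  qed
  also have "\<dots> = real n * (\<Sum>i<L. real i)" by (simp add: sum_distrib_left)
  also have "(\<Sum>i<L. real i) = real L * (real L - 1) / 2"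
    by (induction L) (auto simp: field_simps)
  finally show ?thesis by simp
qed

text \<open>Either all points are so far apart that the truncation is inactive and the Vandermonde
  bound applies, or one close pair, possibly a repeated point, makes the sum large by
  itself.\<close>

lemma pair_sum_trunc_log_kernel_ge:
  assumes E: "\<And>z w. z \<in> E \<Longrightarrow> w \<in> E \<Longrightarrow> dist z w \<le> R" "1 \<le> R"
    and B: "\<And>A. finite A \<Longrightarrow> A \<subseteq> E \<Longrightarrow> card A = m \<Longrightarrow> ln (abs_vandermonde A) \<le> - B"
  obtains e where "0 < e" "e \<le> 1"
    "\<And>xs. length xs = m \<Longrightarrow> set xs \<subseteq> E \<Longrightarrow> B \<le> pair_sum (trunc_log_kernel e R) xs"
proof
  \<comment> \<open>Then \<open>- ln e\<close> covers the possible loss \<open>m ^ 2 * ln R\<close>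
    from the other pairs and still leaves the absolute value of \<open>B\<close>.\<close>
  define e where "e = exp (- (\<bar>B\<bar> + (real m)\<^sup>2 * ln R))"
  have lnR: "0 \<le> ln R" using E by simp
  show e0: "0 < e" by (simp add: e_def)
  have "0 \<le> (real m)\<^sup>2 * ln R" using lnR by simp
  then show e1: "e \<le> 1" by (simp add: e_def)
  fix xs :: "complex list" assume xs: "length xs = m" "set xs \<subseteq> E"
  show "B \<le> pair_sum (trunc_log_kernel e R) xs"
  proof (cases "sorted_wrt (\<lambda>x y. trunc_log_kernel e R x y < - ln e) xs")
    case True
    have far: "e < dist x y" if "trunc_log_kernel e R x y < - ln e" for x y
      using that by (cases "e < dist x y") (auto simp: trunc_log_kernel_def max_def split: if_splits)
    have sep: "sorted_wrt (\<lambda>x y. e < dist x y) xs"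
      by (rule sorted_wrt_mono_rel[OF far True])
    then have "distinct xs" using e0
      by (induction xs) auto
    have "sorted_wrt (\<lambda>x y. trunc_log_kernel e R x y = - ln (dist x y)) xs"
      using sep xs E e0 by (intro sorted_wrt_mono_rel[OF _ sep] trunc_log_kernel_eq) auto
    then have "pair_sum (trunc_log_kernel e R) xs = - ln (abs_vandermonde (set xs))"
      using pair_sum_ln_dist[OF \<open>distinct xs\<close>] by (simp add: pair_sum_cong pair_sum_uminus)
    then show ?thesis
      using B[of "set xs"] xs distinct_card[OF \<open>distinct xs\<close>] by simp
  next
    case False
    have "- ln e - (real (length xs))\<^sup>2 * ln R \<le> pair_sum (trunc_log_kernel e R) xs"
      using False lnR E(2) e0 e1 trunc_log_kernel_bounds(1)[of e R]
      by (intro pair_sum_lower_big_pair) auto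
    then show ?thesis using xs by (simp add: e_def)
  qed
qed

text \<open>The mean of the pair sum over \<open>m\<close> independent points is
  \<open>m (m - 1) / 2\<close> times the energy, so a lower bound valid for all
  \<open>m\<close>-tuples passes to the energy.\<close>

lemma log_energy_ge_abs_vandermonde:
  assumes \<mu>: "\<mu> \<in> prob_measures_on E" and E: "compact E" and m: "2 \<le> m"
    and B: "\<And>A. finite A \<Longrightarrow> A \<subseteq> E \<Longrightarrow> card A = m \<Longrightarrow> ln (abs_vandermonde A) \<le> - B"
  shows "ereal (2 * B / (real m * (real m - 1))) \<le> log_energy \<mu>"
proof -
  interpret prob_space \<mu> using \<mu> by (simp add: prob_measures_on_def)
  have [measurable_cong]: "sets \<mu> = sets borel" using \<mu> by (simp add: prob_measures_on_def)
  have Eb: "E \<in> sets borel" using E by (simp add: compact_imp_closed)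
  have AE_E: "AE z in \<mu>. z \<in> E"
    using \<mu> Eb by (subst AE_in_set_eq_1) (auto simp: prob_measures_on_def emeasure_eq_measure)
  obtain R' where "\<And>z w. z \<in> E \<Longrightarrow> w \<in> E \<Longrightarrow> dist z w \<le> R'"
    using compact_imp_bounded[OF E] diameter_bounded_bound by blast
  then obtain R where R: "1 \<le> R" "\<And>z w. z \<in> E \<Longrightarrow> w \<in> E \<Longrightarrow> dist z w \<le> R"
    by (metis max.cobounded1 max.coboundedI2)
  obtain e where e: "0 < e" "e \<le> 1"
    "\<And>xs. length xs = m \<Longrightarrow> set xs \<subseteq> E \<Longrightarrow> B \<le> pair_sum (trunc_log_kernel e R) xs"
    using pair_sum_trunc_log_kernel_ge[OF R(2,1) B] by blast
  have "case_prod (trunc_log_kernel e R) \<in> borel_measurable (\<mu> \<Otimes>\<^sub>M \<mu>)"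
    using e by measurable
  then have "B \<le> real m * (real m - 1) / 2 * (\<integral>w. \<integral>z. trunc_log_kernel e R w z \<partial>\<mu> \<partial>\<mu>)"
    using e R
    by (intro integral_pair_sum_lower[OF prob_space_axioms AE_E, where c = "\<bar>ln R\<bar> + \<bar>ln e\<bar>"] abs_trunc_log_kernel_le
        trunc_log_kernel_commute) auto
  then have "2 * B / (real m * (real m - 1)) \<le> (\<integral>w. \<integral>z. trunc_log_kernel e R w z \<partial>\<mu> \<partial>\<mu>)"
    using m by (simp add: divide_le_eq field_simps)
  then show ?thesis
    using log_energy_ge[OF \<mu> Eb R e(1,2)] by (meson ereal_less_eq(3) order.trans)
qed

text \<open>With \<open>m = L * n\<close> points, the factors \<open>Suc k\<close> and
  \<open>\<rho> ^ n\<close> contribute only \<open>O(m ln m)\<close> to the logarithm of the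
  Vandermonde product. This vanishes against \<open>m (m - 1)\<close>, and the powers of
  \<open>M\<close> alone determine the limit.\<close>

lemma log_energy_ge_monic_poly:
  assumes E: "compact E" and \<mu>: "\<mu> \<in> prob_measures_on E"
    and P: "degree P = n" "0 < n" "lead_coeff P = 1"
    and M: "0 < M" "\<And>z. z \<in> E \<Longrightarrow> cmod (poly P z) \<le> M"
  shows "ereal (- ln M / real n) \<le> log_energy \<mu>"
proof -
  obtain \<rho>' where "\<And>z. z \<in> E \<Longrightarrow> cmod z \<le> \<rho>'"
    using compact_imp_bounded[OF E] by (auto simp: bounded_iff)
  then obtain \<rho> where \<rho>: "1 \<le> \<rho>" "\<And>z. z \<in> E \<Longrightarrow> cmod z \<le> \<rho>"
    by (metis max.cobounded1 max.coboundedI2)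
  define T where "T k = monom 1 (k mod n) * P ^ (k div n)" for k
  define t where "t k = \<rho> ^ n * M ^ (k div n)" for k
  have T: "degree (T k) = k" "lead_coeff (T k) = 1" for k
    using degree_lead_coeff_monom_mult_power[OF P(1,3), of "k mod n" "k div n"] by (simp_all add: T_def)
  have Tt: "cmod (poly (T k) z) \<le> t k" if "z \<in> E" for k z
    unfolding T_def t_def using \<rho> M that P(2)
    by (intro norm_monom_mult_power_le) (auto simp: less_imp_le)
  have t0: "0 < t k" for k using \<rho>(1) M(1) by (simp add: t_def)
  \<comment> \<open>The three terms bound the contributions of the factors \<open>Suc k\<close>,
    each at most \<open>L * n\<close>, of \<open>\<rho> ^ n\<close>, and of the powers of
    \<open>M\<close>.\<close>
  define B where "B L = - (real (L*n) * ln (real (L*n)) + real (L*n) * (real n * ln \<rho>)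
    + real n * real L * (real L - 1) / 2 * ln M)" for L
  have bound: "ln (abs_vandermonde A) \<le> - B L"
    if A: "finite A" "A \<subseteq> E" "card A = L * n" and L: "0 < L" for A L
  proof -
    have "ln (abs_vandermonde A) \<le> ln (\<Prod>k<L*n. real (Suc k) * t k)"
      using abs_vandermonde_le_prod_chebyshev[OF T Tt A(1,2)] abs_vandermonde_pos[of A] A(3)
      by (intro ln_mono) auto
    also have "\<dots> = (\<Sum>k<L*n. ln (real (Suc k) * t k))"
      using t0[THEN less_imp_neq] by (intro ln_prod) (auto simp: eq_commute[of 0])
    also have "\<dots> = (\<Sum>k<L*n. ln (real (Suc k)) + real n * ln \<rho> + real (k div n) * ln M)"
      using \<rho>(1) M(1) t0
      by (intro sum.cong refl) (simp add: t_def ln_mult ln_realpow del: of_nat_Suc)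
    also have "\<dots> \<le> (\<Sum>k<L*n. ln (real (L*n)) + real n * ln \<rho> + real (k div n) * ln M)"
      by (intro sum_mono add_mono ln_mono order.refl) (auto simp del: of_nat_mult of_nat_Suc)
    also have "\<dots> = - B L"
      unfolding sum.distrib sum_distrib_right[symmetric] sum_div_nat[OF P(2)]
      by (simp add: B_def algebra_simps)
    finally show ?thesis .
  qed
  have "ereal (2 * B L / (real (L*n) * (real (L*n) - 1))) \<le> log_energy \<mu>" if "2 \<le> L" for L
  proof (rule log_energy_ge_abs_vandermonde[OF \<mu> E])
    have "2 * 1 \<le> L * n" using that P(2) by (intro mult_le_mono) auto
    then show "2 \<le> L * n" by simp
  qed (use bound that in auto)
  then have ev: "\<forall>\<^sub>F L in sequentially. ereal (2 * B L / (real (L*n) * (real (L*n) - 1))) \<le> log_energy \<mu>"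
    by (rule eventually_sequentiallyI)
  have "(\<lambda>L. 2 * B L / (real (L*n) * (real (L*n) - 1))) \<longlonglongrightarrow> - ln M / real n"
  proof -
    define c d N where "c = real n * ln \<rho>" and "d = ln M" and "N = real n"
    have "0 < N" using P(2) by (simp add: N_def)
    then have "(\<lambda>L. - (2 * ln (real L * N) + 2 * c + (real L - 1) * d) / (real L * N - 1)) \<longlonglongrightarrow> - d / N"
      by real_asymp (simp add: divide_inverse)
    moreover have "\<forall>\<^sub>F L in sequentially. - (2 * ln (real L * N) + 2 * c + (real L - 1) * d) / (real L * N - 1)
        = 2 * B L / (real (L*n) * (real (L*n) - 1))"
      using eventually_gt_at_top[of 0]
    proof eventually_elim
      case (elim L)
      have "2 * B L = (real L * N) * (- (2 * ln (real L * N) + 2 * c + (real L - 1) * d))"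
        by (simp add: B_def c_def d_def N_def field_simps)
      then show ?case using elim \<open>0 < N\<close> by (simp add: N_def)
    qed
    ultimately show ?thesis unfolding d_def N_def by (rule Lim_transform_eventually)
  qed
  then have "(\<lambda>L. ereal (2 * B L / (real (L*n) * (real (L*n) - 1)))) \<longlonglongrightarrow> ereal (- ln M / real n)"
    by simp
  then show ?thesis by (rule tendsto_upperbound[OF _ ev]) simp
qed

section \<open>Schoenberg's space-filling curve\<close>

text \<open>An even function of period 2 that is 0 on \<open>[0, 1/3]\<close> and 1 on
  \<open>[2/3, 1]\<close>; writing it with the cosine gives continuity and periodicity at
  once.\<close>

definition schoenberg_step :: "real \<Rightarrow> real" where
  "schoenberg_step t = max 0 (min 1 (1 / 2 - cos (pi * t)))"

text \<open>Used for \<open>i = 0\<close> and \<open>i = 1\<close>: the ternary digits of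
  \<open>t\<close> with indices of the parity of \<open>i\<close> act as binary digits of this
  coordinate.\<close>

definition schoenberg_coord :: "nat \<Rightarrow> real \<Rightarrow> real" where
  "schoenberg_coord i t = (\<Sum>n. schoenberg_step (3 ^ (2 * n + i) * t) / 2 ^ Suc n)"

lemma continuous_on_schoenberg_coord: "continuous_on UNIV (schoenberg_coord i)"
proof -
  have "uniform_limit UNIV (\<lambda>N t. \<Sum>n<N. schoenberg_step (3 ^ (2 * n + i) * t) / 2 ^ Suc n)
      (\<lambda>t. \<Sum>n. schoenberg_step (3 ^ (2 * n + i) * t) / 2 ^ Suc n) sequentially"
  proof (rule Weierstrass_m_test)
    show "norm (schoenberg_step (3 ^ (2 * n + i) * t) / 2 ^ Suc n) \<le> (1 / 2) ^ Suc n" for n t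
      by (auto simp: schoenberg_step_def power_divide divide_right_mono)
    show "summable (\<lambda>n. (1 / 2 :: real) ^ Suc n)" by simp
  qed
  then have "continuous_on UNIV (\<lambda>t. \<Sum>n. schoenberg_step (3 ^ (2 * n + i) * t) / 2 ^ Suc n)"
    by (rule uniform_limit_theorem[rotated])
      (auto simp: schoenberg_step_def intro!: always_eventually continuous_intros)
  then show ?thesis by (simp add: schoenberg_coord_def[abs_def])
qed

lemma binary_expansion:
  assumes "0 \<le> x" "x < (1::real)"
  obtains b :: "nat \<Rightarrow> bool" where "(\<lambda>n. of_bool (b n) / 2 ^ Suc n) sums x"
proof
  define b where "b n = odd \<lfloor>2 ^ Suc n * x\<rfloor>" for n
  have step: "real_of_int \<lfloor>2 * y\<rfloor> = 2 * of_int \<lfloor>y\<rfloor> + of_bool (odd \<lfloor>2 * y\<rfloor>)" for y :: real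
  proof -
    have "\<lfloor>2 * y\<rfloor> = 2 * \<lfloor>y\<rfloor> \<or> \<lfloor>2 * y\<rfloor> = 2 * \<lfloor>y\<rfloor> + 1" by linarith
    then show ?thesis by auto
  qed
  have partial: "(\<Sum>n<N. of_bool (b n) / 2 ^ Suc n) = (of_int \<lfloor>2 ^ N * x\<rfloor> / 2 ^ N :: real)" for N
  proof (induction N)
    case 0
    have "\<lfloor>x\<rfloor> = 0" using assms by linarith
    then show ?case by simp
  next
    case (Suc N)
    then show ?case using step[of "2 ^ N * x"] by (simp add: b_def field_simps)
  qed
  have "(\<lambda>N. of_int \<lfloor>2 ^ N * x\<rfloor> / 2 ^ N) \<longlonglongrightarrow> x"
  proof (rule real_tendsto_sandwich)
    show "\<forall>\<^sub>F N in sequentially. x - (1 / 2) ^ N \<le> of_int \<lfloor>2 ^ N * x\<rfloor> / 2 ^ N"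
    proof (intro always_eventually allI)
      fix N
      have "2 ^ N * x - 1 \<le> of_int \<lfloor>2 ^ N * x\<rfloor>" by linarith
      then have "(2 ^ N * x - 1) / 2 ^ N \<le> of_int \<lfloor>2 ^ N * x\<rfloor> / 2 ^ N"
        by (rule divide_right_mono) simp
      then show "x - (1 / 2) ^ N \<le> of_int \<lfloor>2 ^ N * x\<rfloor> / 2 ^ N"
        by (simp add: diff_divide_distrib power_divide)
    qed
    show "\<forall>\<^sub>F N in sequentially. of_int \<lfloor>2 ^ N * x\<rfloor> / 2 ^ N \<le> x"
      by (intro always_eventually allI) (simp add: divide_le_eq mult.commute)
    show "(\<lambda>N. x - (1 / 2) ^ N) \<longlonglongrightarrow> x"
      using tendsto_diff[OF tendsto_const LIMSEQ_power_zero[of "1/2::real"], of x] by simp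
  qed simp
  then show "(\<lambda>n. of_bool (b n) / 2 ^ Suc n) sums x"
    unfolding sums_def partial .
qed

text \<open>The witness has the ternary digits \<open>2 * c k\<close>. Multiplication by
  \<open>3 ^ k\<close> splits off an even integer, invisible to a function of period 2, and the
  remaining tail \<open>T k\<close> lies in \<open>[0, 1/3]\<close> or \<open>[2/3, 1]\<close>
  according to its first digit.\<close>

lemma schoenberg_step_ternary:
  fixes c :: "nat \<Rightarrow> bool"
  obtains t where "0 \<le> t" "t \<le> 1" "\<And>k. schoenberg_step (3 ^ k * t) = of_bool (c k)"
proof
  define f where "f k j = 2 * of_bool (c (j + k)) / (3::real) ^ Suc j" for k j
  define T where "T k = (\<Sum>j. f k j)" for k
  have geo: "(\<lambda>j. 2 / (3::real) ^ Suc j) sums 1"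
    using sums_mult[OF geometric_sums[of "1/3::real"], of "2/3"] by (simp add: power_divide)
  have sf: "summable (f k)" for k
    by (rule summable_comparison_test'[OF sums_summable[OF geo], of 0]) (auto simp: f_def)
  have T0: "0 \<le> T k" for k unfolding T_def by (intro suminf_nonneg sf) (auto simp: f_def)
  have T1: "T k \<le> 1" for k
  proof -
    have "T k \<le> (\<Sum>j. 2 / (3::real) ^ Suc j)"
      unfolding T_def by (intro suminf_le sf sums_summable[OF geo]) (auto simp: f_def)
    then show ?thesis using sums_unique[OF geo] by simp
  qed
  have rec: "3 * T k = 2 * of_bool (c k) + T (Suc k)" for k
  proof -
    have "T k = f k 0 + (\<Sum>j. f k (Suc j))"
      unfolding T_def using suminf_split_head[OF sf[of k]] by simp
    also have "(\<Sum>j. f k (Suc j)) = (\<Sum>j. f (Suc k) j / 3)"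
      by (simp add: f_def mult.commute)
    also have "\<dots> = T (Suc k) / 3" unfolding T_def by (rule suminf_divide[OF sf])
    finally show ?thesis by (simp add: f_def)
  qed
  have shift: "\<exists>N::int. 3 ^ k * T 0 = T k + 2 * of_int N" for k
  proof (induction k)
    case 0
    show ?case by (intro exI[of _ 0]) simp
  next
    case (Suc k)
    then obtain N :: int where "3 ^ k * T 0 = T k + 2 * of_int N" by blast
    then have "3 ^ Suc k * T 0 = 3 * T k + 6 * of_int N" by simp
    also have "\<dots> = T (Suc k) + 2 * of_int (3 * N + of_bool (c k))" using rec[of k] by simp
    finally show ?case by blast
  qed
  have step: "schoenberg_step (T k) = of_bool (c k)" for k
  proof (cases "c k")
    case True
    then have "2 / 3 \<le> T k" using rec[of k] T0[of "Suc k"] by simp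
    then have "cos (pi * T k) \<le> cos (2 / 3 * pi)"
      using T1[of k] by (intro cos_monotone_0_pi_le) (auto simp: mult.commute)
    then show ?thesis using True by (simp add: schoenberg_step_def cos_120 cos_120')
  next
    case False
    then have "T k \<le> 1 / 3" using rec[of k] T1[of "Suc k"] by simp
    then have "cos (pi / 3) \<le> cos (pi * T k)"
      using T0[of k] by (intro cos_monotone_0_pi_le) auto
    then show ?thesis using False by (simp add: schoenberg_step_def cos_60)
  qed
  show "0 \<le> T 0" "T 0 \<le> 1" by (rule T0, rule T1)
  show "schoenberg_step (3 ^ k * T 0) = of_bool (c k)" for k
  proof -
    obtain N :: int where N: "3 ^ k * T 0 = T k + 2 * of_int N" using shift by blast
    have "cos (pi * (T k + 2 * of_int N)) = cos (pi * T k + 2 * pi * of_int N)"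
      by (simp add: algebra_simps)
    also have "\<dots> = cos (pi * T k)"
      by (simp add: cos_add cos_int_2pin sin_int_2pin)
    finally show ?thesis unfolding N using step[of k] by (simp add: schoenberg_step_def)
  qed
qed

text \<open>The binary digits of \<open>x\<close> and \<open>y\<close> are interleaved to prescribe
  the ternary digits of \<open>t\<close>.\<close>

lemma schoenberg_surj:
  assumes "0 \<le> x" "x < 1" "0 \<le> y" "y < 1"
  obtains t where "0 \<le> t" "t \<le> 1" "schoenberg_coord 0 t = x" "schoenberg_coord 1 t = y"
proof -
  obtain a b :: "nat \<Rightarrow> bool" where ab: "(\<lambda>n. of_bool (a n) / 2 ^ Suc n) sums x" "(\<lambda>n. of_bool (b n) / 2 ^ Suc n) sums y"
    using binary_expansion assms by metis
  obtain t where t: "0 \<le> t" "t \<le> 1"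
    "\<And>k. schoenberg_step (3 ^ k * t) = of_bool (if even k then a (k div 2) else b (k div 2))"
    using schoenberg_step_ternary[of "\<lambda>k. if even k then a (k div 2) else b (k div 2)"] by blast
  have "schoenberg_coord 0 t = x" "schoenberg_coord 1 t = y"
    unfolding schoenberg_coord_def t(3) using ab[THEN sums_unique] by simp_all
  then show ?thesis using t that by blast
qed

text \<open>Schoenberg's curve transports measures on \<open>E\<close> to the line, where Helly's and Skorohod's
  theorems are available.\<close>

lemma bounded_subset_continuous_curve:
  fixes E :: "complex set"
  assumes "bounded E"
  obtains \<phi> :: "real \<Rightarrow> complex" where "continuous_on UNIV \<phi>" "E \<subseteq> \<phi> ` {0..1}"
proof -
  obtain r where r: "0 < r" "\<And>z. z \<in> E \<Longrightarrow> cmod z < r"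
    using assms bounded_pos_less by metis
  define \<phi> where "\<phi> t = Complex (r * (2 * schoenberg_coord 0 t - 1)) (r * (2 * schoenberg_coord 1 t - 1))" for t
  have "continuous_on UNIV \<phi>"
    unfolding \<phi>_def by (intro continuous_intros continuous_on_schoenberg_coord)
  moreover have "E \<subseteq> \<phi> ` {0..1}"
  proof
    fix z assume "z \<in> E"
    then have "\<bar>Re z\<bar> < r" "\<bar>Im z\<bar> < r"
      using r(2) abs_Re_le_cmod[of z] abs_Im_le_cmod[of z] by (meson le_less_trans)+
    then obtain t where "0 \<le> t" "t \<le> 1"
      "schoenberg_coord 0 t = (Re z / r + 1) / 2" "schoenberg_coord 1 t = (Im z / r + 1) / 2"
      using r(1) schoenberg_surj[of "(Re z / r + 1) / 2" "(Im z / r + 1) / 2"]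
      by (auto simp: field_simps abs_less_iff)
    then show "z \<in> \<phi> ` {0..1}"
      using r(1) by (intro image_eqI[of _ _ t]) (auto simp: \<phi>_def complex_eq_iff field_simps)
  qed
  ultimately show ?thesis using that by blast
qed

section \<open>Weak limits of almost extremal point sets\<close>

text \<open>The measures are lifted to \<open>[0, 1]\<close> along a curve covering
  \<open>E\<close>. There they are tight, a subsequence converges weakly, and Skorohod's theorem
  realizes it by pointwise convergent random variables, which the curve maps back to the
  plane.\<close>

lemma compact_pmf_weak_limit:
  fixes E :: "complex set" and p :: "nat \<Rightarrow> complex pmf"
  assumes E: "compact E" and p: "\<And>n. set_pmf (p n) \<subseteq> E"
  obtains \<Omega> :: "real measure" and r :: "nat \<Rightarrow> nat" and Z :: "nat \<Rightarrow> real \<Rightarrow> complex" and Y :: "real \<Rightarrow> complex"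
  where "prob_space \<Omega>" "strict_mono r" "\<And>n. Z n \<in> borel_measurable \<Omega>" "Y \<in> borel_measurable \<Omega>"
    "\<And>n. distr \<Omega> borel (Z n) = distr (measure_pmf (p (r n))) borel (\<lambda>z. z)"
    "\<And>x. x \<in> space \<Omega> \<Longrightarrow> (\<lambda>n. Z n x) \<longlonglongrightarrow> Y x"
    "AE x in \<Omega>. Y x \<in> E"
proof -
  obtain \<phi> :: "real \<Rightarrow> complex" where \<phi>: "continuous_on UNIV \<phi>" "E \<subseteq> \<phi> ` {0..1}"
    using bounded_subset_continuous_curve[OF compact_imp_bounded[OF E]] by blast
  have [measurable]: "\<phi> \<in> borel_measurable borel"
    using \<phi>(1) by (rule borel_measurable_continuous_onI)
  obtain g where g: "\<And>z. z \<in> E \<Longrightarrow> 0 \<le> g z" "\<And>z. z \<in> E \<Longrightarrow> g z \<le> 1" "\<And>z. z \<in> E \<Longrightarrow> \<phi> (g z) = z"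
  proof -
    have "\<forall>z\<in>E. \<exists>t. 0 \<le> t \<and> t \<le> 1 \<and> \<phi> t = z" using \<phi>(2) by fastforce
    then show ?thesis using that by metis
  qed
  \<comment> \<open>The section \<open>g\<close> of the curve is arbitrary; it is measurable because
    every set is measurable for a \<open>pmf\<close>.\<close>
  define \<nu> where "\<nu> n = distr (measure_pmf (p n)) borel g" for n
  have \<nu>: "real_distribution (\<nu> n)" for n
    unfolding \<nu>_def by (intro prob_space.real_distribution_distr prob_space_measure_pmf) simp
  \<comment> \<open>Tightness is expressed by intervals open on the left, so the left end must lie
    below 0.\<close>
  have "measure (\<nu> n) {-1<..1} = 1" for n
  proof -
    interpret real_distribution "\<nu> n" by (rule \<nu>)
    have "AE z in measure_pmf (p n). g z \<in> {-1<..1}"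
      using p[of n] g by (fastforce simp: AE_measure_pmf_iff)
    then have "AE x in \<nu> n. x \<in> {-1<..1}" unfolding \<nu>_def by (subst AE_distr_iff) auto
    then show ?thesis by (subst prob_eq_1) auto
  qed
  then have "tight \<nu>"
    unfolding tight_def using \<nu> by (intro conjI allI impI exI[of _ "-1"] exI[of _ 1]) auto
  from tight_imp_convergent_subsubsequence[OF this strict_mono_id] obtain r M
    where r: "strict_mono r" and M: "real_distribution M" and conv: "weak_conv_m (\<nu> \<circ> id \<circ> r) M"
    by blast
  obtain \<Omega> :: "real measure" and X :: "nat \<Rightarrow> real \<Rightarrow> real" and W :: "real \<Rightarrow> real"
    where \<Omega>: "prob_space \<Omega>" "\<And>n. X n \<in> borel_measurable \<Omega>" "\<And>n. distr \<Omega> borel (X n) = \<nu> (r n)"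
      "W \<in> borel_measurable \<Omega>" "\<And>x. x \<in> space \<Omega> \<Longrightarrow> (\<lambda>n. X n x) \<longlonglongrightarrow> W x"
    using Skorohod[of "\<nu> \<circ> id \<circ> r" M] \<nu> M conv by (simp add: o_def) metis
  note [measurable] = \<Omega>(2,4)
  have distr: "distr \<Omega> borel (\<lambda>x. \<phi> (X n x)) = distr (measure_pmf (p (r n))) borel (\<lambda>z. z)" for n
  proof -
    have "distr \<Omega> borel (\<lambda>x. \<phi> (X n x)) = distr (distr \<Omega> borel (X n)) borel \<phi>"
      by (subst distr_distr) (auto simp: o_def)
    also have "\<dots> = distr (measure_pmf (p (r n))) borel (\<lambda>z. \<phi> (g z))"
      by (simp add: \<Omega>(3) \<nu>_def distr_distr o_def)
    also have "\<dots> = distr (measure_pmf (p (r n))) borel (\<lambda>z. z)"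
      using p[of "r n"] g(3) by (intro distr_cong_AE) (auto simp: AE_measure_pmf_iff)
    finally show ?thesis .
  qed
  have lim: "(\<lambda>n. \<phi> (X n x)) \<longlonglongrightarrow> \<phi> (W x)" if "x \<in> space \<Omega>" for x
    using \<Omega>(5)[OF that] \<phi>(1) by (auto intro!: continuous_on_tendsto_compose[of UNIV \<phi>])
  have "AE x in \<Omega>. \<phi> (X n x) \<in> E" for n
  proof -
    have "AE z in distr (measure_pmf (p (r n))) borel (\<lambda>z. z). z \<in> E"
      using p[of "r n"] E by (subst AE_distr_iff) (auto simp: AE_measure_pmf_iff compact_imp_closed)
    then have "AE z in distr \<Omega> borel (\<lambda>x. \<phi> (X n x)). z \<in> E" unfolding distr .
    then show ?thesis using E by (subst (asm) AE_distr_iff) (auto simp: compact_imp_closed)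
  qed
  then have "AE x in \<Omega>. \<forall>n. \<phi> (X n x) \<in> E" by (simp add: AE_all_countable)
  then have "AE x in \<Omega>. \<phi> (W x) \<in> E"
    using AE_space
  proof eventually_elim
    case (elim x)
    then show ?case 
      by (intro closed_sequentially[OF compact_imp_closed[OF E] _ lim]) auto
  qed
  with \<Omega>(1) r distr lim show ?thesis
    by (intro that[of \<Omega> r "\<lambda>n x. \<phi> (X n x)" "\<lambda>x. \<phi> (W x)"]) auto
qed

text \<open>After a change of variables all integrals are over the fixed space
  \<open>\<Omega>\<close>, and dominated convergence applies first to the inner and then to the
  outer one.\<close>

lemma tendsto_double_integral:
  fixes K :: "complex \<Rightarrow> complex \<Rightarrow> real"
  assumes "prob_space \<Omega>" and Z: "\<And>n. Z n \<in> borel_measurable \<Omega>" "Y \<in> borel_measurable \<Omega>"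
    and lim: "\<And>x. x \<in> space \<Omega> \<Longrightarrow> (\<lambda>n. Z n x) \<longlonglongrightarrow> Y x"
    and K: "continuous_on UNIV (case_prod K)" "\<And>z w. \<bar>K z w\<bar> \<le> c"
  shows "(\<lambda>n. \<integral>w. \<integral>z. K w z \<partial>distr \<Omega> borel (Z n) \<partial>distr \<Omega> borel (Z n)) \<longlonglongrightarrow>
    (\<integral>w. \<integral>z. K w z \<partial>distr \<Omega> borel Y \<partial>distr \<Omega> borel Y)"
proof -
  interpret prob_space \<Omega> by fact
  note [measurable] = Z
  have Km: "case_prod K \<in> borel_measurable (borel \<Otimes>\<^sub>M borel)"
    unfolding borel_prod using K(1) by (rule borel_measurable_continuous_onI)
  note [measurable] = Km
  have eq: "(\<integral>w. \<integral>z. K w z \<partial>distr \<Omega> borel U \<partial>distr \<Omega> borel U) = (\<integral>x. \<integral>y. K (U x) (U y) \<partial>\<Omega> \<partial>\<Omega>)"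
    if [measurable]: "U \<in> borel_measurable \<Omega>" for U
  proof -
    interpret D: prob_space "distr \<Omega> borel U" by (rule prob_space_distr) fact
    have "(\<lambda>w. \<integral>z. K w z \<partial>distr \<Omega> borel U) \<in> borel_measurable borel"
      by measurable
    moreover have "K w \<in> borel_measurable borel" for w by measurable
    ultimately show ?thesis by (simp add: integral_distr)
  qed
  have inner_bound: "\<bar>\<integral>y. K w (U y) \<partial>\<Omega>\<bar> \<le> c" if [measurable]: "U \<in> borel_measurable \<Omega>" for U w
  proof -
    have "integrable \<Omega> (\<lambda>y. K w (U y))" using K(2) by (intro integrable_const_bound[where B = c]) auto
    moreover have "- c \<le> K w z" "K w z \<le> c" for z using K(2)[of w z] by linarith+
    ultimately have "(\<integral>y. K w (U y) \<partial>\<Omega>) \<le> c" "- c \<le> (\<integral>y. K w (U y) \<partial>\<Omega>)"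
      by (auto intro!: integral_le_const integral_ge_const)
    then show ?thesis by linarith
  qed
  have inner: "(\<lambda>n. \<integral>y. K (Z n x) (Z n y) \<partial>\<Omega>) \<longlonglongrightarrow> (\<integral>y. K (Y x) (Y y) \<partial>\<Omega>)" if x: "x \<in> space \<Omega>" for x
  proof (rule integral_dominated_convergence[where w = "\<lambda>_. c"])
    have "(\<lambda>n. K (Z n x) (Z n y)) \<longlonglongrightarrow> K (Y x) (Y y)" if "y \<in> space \<Omega>" for y
      using continuous_on_tendsto_compose[OF K(1) tendsto_Pair[OF lim[OF x] lim[OF that]]] by simp
    then show "AE y in \<Omega>. (\<lambda>n. K (Z n x) (Z n y)) \<longlonglongrightarrow> K (Y x) (Y y)" by auto
  qed (use K(2) in auto)
  have "(\<lambda>n. \<integral>x. \<integral>y. K (Z n x) (Z n y) \<partial>\<Omega> \<partial>\<Omega>) \<longlonglongrightarrow> (\<integral>x. \<integral>y. K (Y x) (Y y) \<partial>\<Omega> \<partial>\<Omega>)"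
  proof (rule integral_dominated_convergence[where w = "\<lambda>_. c"])
    show "AE x in \<Omega>. (\<lambda>n. \<integral>y. K (Z n x) (Z n y) \<partial>\<Omega>) \<longlonglongrightarrow> (\<integral>y. K (Y x) (Y y) \<partial>\<Omega>)"
      using inner by auto
  qed (use inner_bound in auto)
  then show ?thesis by (simp add: eq)
qed

text \<open>A maximizer is not needed; maximality up to a factor \<open>2\<close> is lost in the limit anyway.\<close>

lemma near_fekete_set:
  fixes E :: "complex set"
  assumes E: "bounded E" "infinite E"
  obtains A where "finite A" "A \<subseteq> E" "card A = m"
    "\<And>B. finite B \<Longrightarrow> B \<subseteq> E \<Longrightarrow> card B = m \<Longrightarrow> abs_vandermonde B \<le> 2 * abs_vandermonde A"
proof -
  obtain \<rho> where \<rho>: "\<And>z. z \<in> E \<Longrightarrow> cmod z \<le> \<rho>" using E by (auto simp: bounded_iff)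
  define S where "S = abs_vandermonde ` {A. finite A \<and> A \<subseteq> E \<and> card A = m}"
  \<comment> \<open>The monomials serve as monic polynomials here, to show that the supremum is
    finite.\<close>
  have "abs_vandermonde A \<le> (\<Prod>k<m. real (Suc k) * \<rho> ^ k)" if "finite A" "A \<subseteq> E" "card A = m" for A
    using abs_vandermonde_le_prod_chebyshev[of "monom 1" E "\<lambda>k. \<rho> ^ k" A] that \<rho>
    by (simp add: degree_monom_eq poly_monom norm_power power_mono)
  then have bdd: "bdd_above S" 
    unfolding S_def by (intro bdd_aboveI[where M = "\<Prod>k<m. real (Suc k) * \<rho> ^ k"]) blast
  obtain A0 where A0: "finite A0" "A0 \<subseteq> E" "card A0 = m"
    using infinite_arbitrarily_large[OF E(2)] by metis
  then have "abs_vandermonde A0 \<le> Sup S" using bdd by (intro cSup_upper) (auto simp: S_def)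
  then have "Sup S / 2 < Sup S" using abs_vandermonde_pos[of A0] by simp
  moreover have "S \<noteq> {}" using A0 by (auto simp: S_def)
  ultimately obtain s where "s \<in> S" "Sup S / 2 < s"
    using less_cSup_iff[OF _ bdd] by blast
  then obtain A where A: "finite A" "A \<subseteq> E" "card A = m" "Sup S / 2 < abs_vandermonde A"
    by (auto simp: S_def)
  show ?thesis
  proof (rule that[OF A(1-3)])
    fix B assume "finite B" "B \<subseteq> E" "card B = m"
    then have "abs_vandermonde B \<le> Sup S" using bdd by (intro cSup_upper) (auto simp: S_def)
    then show "abs_vandermonde B \<le> 2 * abs_vandermonde A" using A(4) by simp
  qed
qed

text \<open>An exchange argument: \<open>a\<close> is replaced by a point \<open>z\<close> of
  \<open>E\<close> at which the monic polynomial with roots \<open>A - {a}\<close> is large. Almost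
  maximality of \<open>A\<close> lets the Vandermonde product grow at most by the factor 2.\<close>

lemma near_fekete_set_sum_ln_dist:
  assumes \<tau>: "0 < \<tau>" "\<And>P. 0 < degree P \<Longrightarrow> lead_coeff P = 1 \<Longrightarrow> \<exists>z\<in>E. \<tau> ^ degree P \<le> cmod (poly P z)"
    and A: "finite A" "A \<subseteq> E" "2 \<le> card A"
      "\<And>B. finite B \<Longrightarrow> B \<subseteq> E \<Longrightarrow> card B = card A \<Longrightarrow> abs_vandermonde B \<le> 2 * abs_vandermonde A"
    and a: "a \<in> A"
  shows "(real (card A) - 1) * ln \<tau> - ln 2 \<le> (\<Sum>b\<in>A-{a}. ln (dist a b))"
proof -
  define P where "P = (\<Prod>b\<in>A-{a}. [:-b, 1:])"
  have deg: "degree P = card A - 1"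
    unfolding P_def using A(1) a by (subst degree_prod_eq_sum_degree) auto
  have "lead_coeff P = 1" unfolding P_def lead_coeff_prod by simp
  then obtain z where z: "z \<in> E" "\<tau> ^ degree P \<le> cmod (poly P z)"
    using \<tau>(2)[of P] A(3) deg by auto
  have Pz: "cmod (poly P z) = (\<Prod>b\<in>A-{a}. dist z b)"
    by (simp add: P_def poly_prod prod_norm[symmetric] dist_norm)
  have pos: "0 < (\<Prod>b\<in>A-{a}. dist a b)" by (intro prod_pos) auto
  \<comment> \<open>The polynomial does not vanish at \<open>z\<close>, so the exchange does not
    lower the number of points.\<close>
  have "0 < cmod (poly P z)" using z(2) \<tau>(1) by (meson less_le_trans zero_less_power)
  then have zA: "z \<notin> A - {a}" using A(1) unfolding Pz by (metis dist_self finite_Diff less_irrefl prod_zero)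
  define B where "B = insert z (A - {a})"
  have rem: "B - {z} = A - {a}" using zA by (auto simp: B_def)
  have "card B = Suc (card (A - {a}))"
    unfolding B_def using A(1) zA by (intro card_insert_disjoint) auto
  then have "card B = card A" using card_Suc_Diff1[OF A(1) a] by simp
  then have "abs_vandermonde B \<le> 2 * abs_vandermonde A"
    using A z by (intro A(4)) (auto simp: B_def)
  moreover have "abs_vandermonde B = abs_vandermonde (A - {a}) * (\<Prod>b\<in>A-{a}. dist z b)"
    using abs_vandermonde_remove[of B z] A(1) unfolding rem by (simp add: B_def)
  ultimately have "abs_vandermonde (A - {a}) * (\<Prod>b\<in>A-{a}. dist z b)
      \<le> abs_vandermonde (A - {a}) * (2 * (\<Prod>b\<in>A-{a}. dist a b))"
    using abs_vandermonde_remove[OF A(1) a] by (simp add: mult.left_commute)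
  then have "(\<Prod>b\<in>A-{a}. dist z b) \<le> 2 * (\<Prod>b\<in>A-{a}. dist a b)"
    by (rule mult_left_le_imp_le) (rule abs_vandermonde_pos)
  then have "\<tau> ^ (card A - 1) \<le> 2 * (\<Prod>b\<in>A-{a}. dist a b)"
    using z(2) by (simp add: Pz deg)
  then have "ln (\<tau> ^ (card A - 1)) \<le> ln (2 * (\<Prod>b\<in>A-{a}. dist a b))"
    using \<tau>(1) by (intro ln_mono) auto
  also have "\<dots> = ln 2 + (\<Sum>b\<in>A-{a}. ln (dist a b))"
    using pos A(1) by (simp add: ln_mult) (subst ln_prod; auto)
  finally show ?thesis using \<tau>(1) A(3) by (simp add: ln_realpow of_nat_diff)
qed

text \<open>For fixed \<open>e\<close>, the diagonal adds at most \<open>- ln e\<close> to each row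
  sum of the truncated kernel, which is negligible after division by the number of points. The limit
  over point sets is taken first, and the truncation is removed afterwards.\<close>

lemma exists_log_energy_le:
  assumes E: "compact E"
    and \<tau>: "0 < \<tau>" "\<And>P. 0 < degree P \<Longrightarrow> lead_coeff P = 1 \<Longrightarrow> \<exists>z\<in>E. \<tau> ^ degree P \<le> cmod (poly P z)"
  obtains \<mu> where "\<mu> \<in> prob_measures_on E" "log_energy \<mu> \<le> ereal (- ln \<tau>)"
proof -
  have Eb: "E \<in> sets borel" using E by (simp add: compact_imp_closed)
  have inf: "infinite E"
  proof
    assume fin: "finite E"
    \<comment> \<open>This polynomial vanishes on \<open>E\<close>; the additional factor ensures
      positive degree even when \<open>E\<close> is empty.\<close>
    define P where "P = (\<Prod>b\<in>E. [:-b, 1:]) * [:0, 1:]"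
    have "(\<Prod>b\<in>E. [:-b, 1:]) \<noteq> 0" using fin by (subst prod_zero_iff) auto
    then have "0 < degree P" unfolding P_def by (subst degree_mult_eq) auto
    moreover have "lead_coeff P = 1" unfolding P_def lead_coeff_mult lead_coeff_prod by simp
    ultimately obtain z where "z \<in> E" "\<tau> ^ degree P \<le> cmod (poly P z)" using \<tau>(2) by blast
    moreover from this have "poly P z = 0" using fin by (auto simp: P_def poly_prod prod_zero_iff)
    ultimately show False using zero_less_power[OF \<tau>(1), of "degree P"] by simp
  qed
  obtain R' where "\<And>z w. z \<in> E \<Longrightarrow> w \<in> E \<Longrightarrow> dist z w \<le> R'"
    using compact_imp_bounded[OF E] diameter_bounded_bound by blast
  then obtain R where R: "1 \<le> R" "\<And>z w. z \<in> E \<Longrightarrow> w \<in> E \<Longrightarrow> dist z w \<le> R"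
    by (metis max.cobounded1 max.coboundedI2)
  define near_fekete where "near_fekete m A \<longleftrightarrow> finite A \<and> A \<subseteq> E \<and> card A = m \<and>
    (\<forall>B. finite B \<longrightarrow> B \<subseteq> E \<longrightarrow> card B = m \<longrightarrow> abs_vandermonde B \<le> 2 * abs_vandermonde A)" for m A
  have "\<exists>A. near_fekete m A" for m
    unfolding near_fekete_def by (rule near_fekete_set[OF compact_imp_bounded[OF E] inf]) blast
  then obtain A where "\<And>m. near_fekete m (A m)" by metis
  then have A: "\<And>m. finite (A m)" "\<And>m. A m \<subseteq> E" "\<And>m. card (A m) = m"
    "\<And>m B. finite B \<Longrightarrow> B \<subseteq> E \<Longrightarrow> card B = m \<Longrightarrow> abs_vandermonde B \<le> 2 * abs_vandermonde (A m)"
    unfolding near_fekete_def by blast+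
  \<comment> \<open>The shift provides the two points that the exchange argument asks for.\<close>
  define p where "p n = pmf_of_set (A (n + 2))" for n
  have ne: "A (n + 2) \<noteq> {}" for n using A(3)[of "n + 2"] by auto
  have pE: "set_pmf (p n) \<subseteq> E" for n unfolding p_def using A(1,2) ne by simp
  obtain \<Omega> :: "real measure" and r :: "nat \<Rightarrow> nat" and Z :: "nat \<Rightarrow> real \<Rightarrow> complex" and Y :: "real \<Rightarrow> complex"
    where \<Omega>: "prob_space \<Omega>" "strict_mono r" "\<And>n. Z n \<in> borel_measurable \<Omega>" "Y \<in> borel_measurable \<Omega>"
    "\<And>n. distr \<Omega> borel (Z n) = distr (measure_pmf (p (r n))) borel (\<lambda>z. z)"
    "\<And>x. x \<in> space \<Omega> \<Longrightarrow> (\<lambda>n. Z n x) \<longlonglongrightarrow> Y x" "AE x in \<Omega>. Y x \<in> E"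
    by (rule compact_pmf_weak_limit[OF E, of p, OF pE]) (rule that)
  interpret \<Omega>: prob_space \<Omega> by fact
  define \<mu> where "\<mu> = distr \<Omega> borel Y"
  interpret \<mu>: prob_space \<mu> unfolding \<mu>_def by (rule \<Omega>.prob_space_distr) fact
  have "AE z in \<mu>. z \<in> E" unfolding \<mu>_def using \<Omega>(4,7) Eb by (subst AE_distr_iff) auto
  then have "measure \<mu> E = 1"
    using Eb by (subst (asm) \<mu>.AE_in_set_eq_1) (auto simp: \<mu>_def)
  then have "emeasure \<mu> E = 1" by (simp add: \<mu>.emeasure_eq_measure)
  then have \<mu>: "\<mu> \<in> prob_measures_on E"
    using \<mu>.prob_space_axioms by (simp add: prob_measures_on_def \<mu>_def)
  have bound: "(\<integral>w. \<integral>z. trunc_log_kernel e R w z \<partial>\<mu> \<partial>\<mu>) \<le> - ln \<tau>" if e: "0 < e" "e \<le> 1" for e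
  proof -
    define I where "I n = (\<integral>w. \<integral>z. trunc_log_kernel e R w z \<partial>distr (measure_pmf (p n)) borel (\<lambda>z. z)
        \<partial>distr (measure_pmf (p n)) borel (\<lambda>z. z))" for n
    \<comment> \<open>An average of row bounds: \<open>ln 2\<close> comes from almost maximality and
      \<open>- ln e\<close> from the diagonal.\<close>
    define u where "u n = (ln 2 - ln e - (real (n + 2) - 1) * ln \<tau>) / real (n + 2)" for n
    have "I n \<le> u n" for n
    proof -
      define B where "B = A (n + 2)"
      have B: "finite B" "B \<subseteq> E" "card B = n + 2" "B \<noteq> {}" using A ne by (auto simp: B_def)
      have [measurable]: "case_prod (trunc_log_kernel e R) \<in> borel_measurable (borel \<Otimes>\<^sub>M borel)"
        using e by measurable
      have "prob_space (distr (measure_pmf (p n)) borel (\<lambda>z. z))"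
        by (rule prob_space.prob_space_distr) (auto intro: prob_space_measure_pmf)
      then interpret D: prob_space "distr (measure_pmf (p n)) borel (\<lambda>z. z)" .
      have "(\<lambda>w. \<integral>z. trunc_log_kernel e R w z \<partial>distr (measure_pmf (p n)) borel (\<lambda>z. z)) \<in> borel_measurable borel"
        by measurable
      moreover have "trunc_log_kernel e R w \<in> borel_measurable borel" for w by measurable
      ultimately have "I n = (\<integral>w. \<integral>z. trunc_log_kernel e R w z \<partial>measure_pmf (p n) \<partial>measure_pmf (p n))"
        unfolding I_def by (simp add: integral_distr)
      also have "\<dots> = (\<Sum>a\<in>B. \<Sum>b\<in>B. trunc_log_kernel e R a b) / real (n + 2) / real (n + 2)"
        using B by (simp add: p_def B_def[symmetric] integral_pmf_of_set sum_divide_distrib del: add_2_eq_Suc')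
      also have "(\<Sum>a\<in>B. \<Sum>b\<in>B. trunc_log_kernel e R a b) \<le> (\<Sum>a\<in>B. ln 2 - ln e - (real (n + 2) - 1) * ln \<tau>)"
      proof (rule sum_mono)
        fix a assume a: "a \<in> B"
        have "(\<Sum>b\<in>B. trunc_log_kernel e R a b) = trunc_log_kernel e R a a + (\<Sum>b\<in>B-{a}. trunc_log_kernel e R a b)"
          using B a by (simp add: sum.remove)
        also have "\<dots> \<le> - ln e + (\<Sum>b\<in>B-{a}. - ln (dist a b))"
        proof (intro add_mono sum_mono)
          show "trunc_log_kernel e R a a \<le> - ln e" using e R by (intro trunc_log_kernel_bounds) auto
          fix b assume b: "b \<in> B - {a}"
          then have "dist a b \<le> R" using R a B by auto
          then show "trunc_log_kernel e R a b \<le> - ln (dist a b)"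
            using b by (auto simp: trunc_log_kernel_def min_absorb2 intro!: ln_mono)
        qed
        also have "(\<Sum>b\<in>B-{a}. - ln (dist a b)) \<le> ln 2 - (real (n + 2) - 1) * ln \<tau>"
          using near_fekete_set_sum_ln_dist[OF \<tau> B(1,2) _ _ a] B(3) A(4)[of _ "n + 2"]
          by (simp add: sum_negf B_def)
        finally show "(\<Sum>b\<in>B. trunc_log_kernel e R a b) \<le> ln 2 - ln e - (real (n + 2) - 1) * ln \<tau>"
          by simp
      qed
      finally show ?thesis using B(3) by (simp add: u_def divide_right_mono)
    qed
    then have Iu: "\<And>n. I (r n) \<le> u (r n)" .
    have "u \<longlonglongrightarrow> - ln \<tau>" unfolding u_def by real_asymp
    then have "(\<lambda>n. u (r n)) \<longlonglongrightarrow> - ln \<tau>"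
      using LIMSEQ_subseq_LIMSEQ[OF _ \<Omega>(2)] by (auto simp: o_def)
    moreover have "(\<lambda>n. I (r n)) \<longlonglongrightarrow> (\<integral>w. \<integral>z. trunc_log_kernel e R w z \<partial>\<mu> \<partial>\<mu>)"
      unfolding I_def \<Omega>(5)[symmetric] \<mu>_def using e R(1)
      by (intro tendsto_double_integral[OF \<Omega>(1,3,4,6), where c = "\<bar>ln R\<bar> + \<bar>ln e\<bar>"]
          continuous_on_trunc_log_kernel abs_trunc_log_kernel_le) auto
    ultimately show ?thesis using Iu by (meson LIMSEQ_le)
  qed
  have "log_energy \<mu> \<le> ereal (- ln \<tau>)" by (rule log_energy_le[OF \<mu> Eb R bound])
  then show ?thesis using \<mu> that by blast
qed

section \<open>Capacity and Chebyshev constants\<close>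

lemma robin_constant_ge_monic_poly:
  assumes "compact E" "0 < degree P" "lead_coeff P = 1"
    and "0 < M" "\<And>z. z \<in> E \<Longrightarrow> cmod (poly P z) \<le> M"
  shows "ereal (- ln M / real (degree P)) \<le> robin_constant E"
  unfolding robin_constant_def
  by (intro INF_greatest log_energy_ge_monic_poly[OF assms(1) _ refl]) (use assms in auto)

text \<open>The polynomial \<open>z\<close> already bounds all energies from below. The value
  \<open>- \<infinity>\<close> has to be excluded because \<open>real_of_ereal\<close> would turn it
  into 0.\<close>

lemma robin_constant_gt_MInfty:
  assumes "compact E"
  shows "robin_constant E \<noteq> - \<infinity>"
proof -
  obtain M where "0 < M" "\<And>z. z \<in> E \<Longrightarrow> cmod z \<le> M"
    using compact_imp_bounded[OF assms] by (metis bounded_pos)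
  then show ?thesis using robin_constant_ge_monic_poly[OF assms, of "[:0, 1:]" M] by auto
qed

lemma log_capacity_power_le:
  assumes E: "compact E" and P: "0 < degree P" "lead_coeff P = 1"
    and M: "0 < M" "\<And>z. z \<in> E \<Longrightarrow> cmod (poly P z) \<le> M"
  shows "log_capacity E ^ degree P \<le> M"
proof (cases "robin_constant E")
  case (real r)
  have "- ln M / real (degree P) \<le> r"
    using robin_constant_ge_monic_poly[OF E P M] real by simp
  then have "real (degree P) * - r \<le> ln M" using P(1) by (simp add: field_simps)
  then have "exp (- r) ^ degree P \<le> exp (ln M)" by (simp only: exp_of_nat_mult[symmetric] exp_le_cancel_iff)
  then show ?thesis using real M(1) by (simp add: log_capacity_def)
next
  case PInf
  then show ?thesis using P(1) M(1) by (simp add: log_capacity_def power_0_left)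
next
  case MInf
  then show ?thesis using robin_constant_gt_MInfty[OF E] by simp
qed

text \<open>Otherwise \<open>exists_log_energy_le\<close> would provide a measure whose energy
  forces the capacity up to \<open>\<tau>\<close>.\<close>

lemma exists_monic_poly_lt_power:
  assumes E: "compact E" and \<tau>: "0 < \<tau>" "log_capacity E < \<tau>"
  obtains P where "0 < degree P" "lead_coeff P = 1" "\<And>z. z \<in> E \<Longrightarrow> cmod (poly P z) < \<tau> ^ degree P"
proof -
  have "\<exists>P. 0 < degree P \<and> lead_coeff P = 1 \<and> (\<forall>z\<in>E. cmod (poly P z) < \<tau> ^ degree P)"
  proof (rule ccontr)
    assume no: "\<not> ?thesis"
    have "\<exists>z\<in>E. \<tau> ^ degree P \<le> cmod (poly P z)" if "0 < degree P" "lead_coeff P = 1" for P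
      using no that by (meson not_le)
    from exists_log_energy_le[OF E \<tau>(1) this] obtain \<mu>
      where "\<mu> \<in> prob_measures_on E" "log_energy \<mu> \<le> ereal (- ln \<tau>)" by blast
    then have le: "robin_constant E \<le> ereal (- ln \<tau>)"
      unfolding robin_constant_def by (rule INF_lower2)
    then obtain r where r: "robin_constant E = ereal r"
      using robin_constant_gt_MInfty[OF E] by (cases "robin_constant E") auto
    have "\<tau> = exp (ln \<tau>)" using \<tau>(1) by simp
    also have "\<dots> \<le> exp (- r)" using le r by simp
    also have "\<dots> = log_capacity E" using r by (simp add: log_capacity_def)
    finally show False using \<tau>(2) by simp
  qed
  then show ?thesis using that by blast
qed

lemma log_capacity_empty: "log_capacity {} = 0"
  by (simp add: log_capacity_def robin_constant_def prob_measures_on_def top_ereal_def)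

section \<open>Norms of monic integer polynomials and the main result\<close>

lemma sup_norm_on_upper:
  assumes "compact E" "continuous_on E f" "z \<in> E"
  shows "cmod (f z) \<le> sup_norm_on E f"
  unfolding sup_norm_on_def
proof (rule cSUP_upper[OF assms(3)])
  have "compact ((\<lambda>z. cmod (f z)) ` E)"
    using assms by (intro compact_continuous_image continuous_intros)
  then show "bdd_above ((\<lambda>z. cmod (f z)) ` E)"
    by (intro bounded_imp_bdd_above compact_imp_bounded)
qed

lemma log_capacity_power_le_sup_norm:
  assumes E: "compact E" "E \<noteq> {}" and P: "P \<in> monic_int_polys n" "0 < n"
  shows "log_capacity E ^ n \<le> sup_norm_on E (poly (map_poly of_int P))"
\<comment> \<open>The capacity bound is available for positive \<open>M\<close> only, so
  \<open>\<delta>\<close> is added to a norm known merely to be nonnegative.\<close>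
proof (rule field_le_epsilon)
  fix \<delta> :: real assume \<delta>: "0 < \<delta>"
  define Q :: "complex poly" where "Q = map_poly of_int P"
  have deg: "degree Q = n"
    using P(1) by (auto simp: Q_def monic_int_polys_def intro!: map_poly_degree_eq)
  then have lead: "lead_coeff Q = 1"
    using P(1) by (auto simp: Q_def monic_int_polys_def coeff_map_poly)
  have upper: "cmod (poly Q z) \<le> sup_norm_on E (poly Q)" if "z \<in> E" for z
    using E(1) that by (intro sup_norm_on_upper continuous_intros)
  then have "0 \<le> sup_norm_on E (poly Q)" using E(2) order.trans[OF norm_ge_zero] by blast
  then have "log_capacity E ^ degree Q \<le> sup_norm_on E (poly Q) + \<delta>"
    using upper \<delta> deg lead P(2)
    by (intro log_capacity_power_le[OF E(1)]) (auto intro: order.trans[OF upper])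
  then show "log_capacity E ^ n \<le> sup_norm_on E (poly (map_poly of_int P)) + \<delta>"
    unfolding deg by (simp only: Q_def)
qed

text \<open>Convergence is a separate conjunct, since \<open>lim\<close> has an unspecified value
  for a divergent sequence.\<close>

theorem theorem1p1:
  fixes E :: "complex set"
  assumes "compact E"
    and "\<And>z. z \<in> E \<Longrightarrow> cnj z \<in> E"
    and "log_capacity E \<ge> 1"
  shows "convergent (monic_int_cheb_seq E) \<and> monic_int_cheb_const E = log_capacity E"
proof -
  define c where "c = log_capacity E"
  define N where "N n = (INF P\<in>monic_int_polys n. sup_norm_on E (poly (map_poly of_int P)))" for n
  have seq: "monic_int_cheb_seq E n = root n (N n)" for n
    by (simp add: monic_int_cheb_seq_def N_def)
  have ne: "E \<noteq> {}" using assms(3) log_capacity_empty by auto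
  have poly_ne: "monic_int_polys n \<noteq> {}" for n
    using degree_monom_eq[of "1::int" n] by (auto simp: monic_int_polys_def intro!: exI[of _ "monom 1 n"])
  have c_le: "c ^ n \<le> sup_norm_on E (poly (map_poly of_int P))" if "P \<in> monic_int_polys n" "0 < n" for P n
    unfolding c_def using assms(1) ne that by (rule log_capacity_power_le_sup_norm)
  have lower: "c \<le> root n (N n)" if "0 < n" for n
  proof -
    have "c ^ n \<le> N n"
      unfolding N_def using poly_ne that c_le by (intro cINF_greatest)
    then have "root n (c ^ n) \<le> root n (N n)" using that by (intro real_root_le_mono)
    then show ?thesis using that assms(3) by (simp add: real_root_power_cancel c_def)
  qed
  have upper: "\<forall>\<^sub>F n in sequentially. root n (N n) < a" if a: "c < a" for a
  proof -
    define \<tau> where "\<tau> = (c + a) / 2"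
    have \<tau>: "c < \<tau>" "\<tau> < a" "1 \<le> \<tau>" using a assms(3) by (simp_all add: \<tau>_def c_def field_simps)
    obtain P where P: "0 < degree P" "lead_coeff P = 1" "\<And>z. z \<in> E \<Longrightarrow> cmod (poly P z) < \<tau> ^ degree P"
      using exists_monic_poly_lt_power[OF assms(1), of \<tau>] \<tau> by (auto simp: c_def)
    obtain C where C: "0 < C" "\<And>n. \<exists>Q\<in>monic_int_polys n. \<forall>z\<in>E.
        cmod (poly (map_poly of_int Q) z) \<le> C * real (Suc n) * \<tau> ^ n"
      using exists_monic_int_polys_geometric[OF compact_imp_bounded[OF assms(1)] assms(2) refl P(1,2) \<tau>(3)]
        P(3) less_imp_le by metis
    have "root n (N n) \<le> root n (2 * C) * root n (real n) * \<tau>" if n: "0 < n" for n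
    proof -
      obtain Q where Q: "Q \<in> monic_int_polys n"
        "\<And>z. z \<in> E \<Longrightarrow> cmod (poly (map_poly of_int Q) z) \<le> C * real (Suc n) * \<tau> ^ n"
        using C(2)[of n] by blast
      \<comment> \<open>The infimum over reals is a lower bound only for a set bounded below; the
        capacity inequality supplies such a bound.\<close>
      have "bdd_below ((\<lambda>P. sup_norm_on E (poly (map_poly of_int P))) ` monic_int_polys n)"
        using c_le n by (intro bdd_belowI2[where m = "c ^ n"])
      then have "N n \<le> sup_norm_on E (poly (map_poly of_int Q))"
        unfolding N_def using Q(1) by (rule cINF_lower)
      also have "\<dots> \<le> C * real (Suc n) * \<tau> ^ n"
        unfolding sup_norm_on_def using ne Q(2) by (rule cSUP_least)
      \<comment> \<open>With \<open>n + 1 \<le> 2 * n\<close>, only the \<open>n\<close>-th roots of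
        a constant and of \<open>n\<close> remain, and both tend to 1.\<close>
      also have "\<dots> \<le> 2 * C * real n * \<tau> ^ n"
        using n C(1) \<tau>(3) by (intro mult_right_mono) auto
      finally have "root n (N n) \<le> root n (2 * C * real n * \<tau> ^ n)"
        using n by (intro real_root_le_mono)
      also have "\<dots> = root n (2 * C) * root n (real n) * \<tau>"
        using n \<tau>(3) by (simp add: real_root_mult real_root_power_cancel)
      finally show ?thesis .
    qed
    then have "\<forall>\<^sub>F n in sequentially. root n (N n) \<le> root n (2 * C) * root n (real n) * \<tau>"
      by (intro eventually_mono[OF eventually_gt_at_top[of 0]])
    moreover have "(\<lambda>n. root n (2 * C) * root n (real n) * \<tau>) \<longlonglongrightarrow> 1 * 1 * \<tau>"
      using C(1) by (intro tendsto_intros LIMSEQ_root_const LIMSEQ_root) auto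
    then have "\<forall>\<^sub>F n in sequentially. root n (2 * C) * root n (real n) * \<tau> < a"
      using \<tau>(2) by (intro order_tendstoD(2)) auto
    ultimately show ?thesis by eventually_elim simp
  qed
  have "monic_int_cheb_seq E \<longlonglongrightarrow> c"
  proof (rule order_tendstoI)
    show "\<forall>\<^sub>F n in sequentially. a < monic_int_cheb_seq E n" if "a < c" for a
      using eventually_gt_at_top[of 0] by eventually_elim (use lower that in \<open>auto simp: seq intro: less_le_trans\<close>)
  qed (simp add: seq upper)
  then show ?thesis
    by (auto simp: monic_int_cheb_const_def c_def convergent_def intro: limI)
qed

end
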